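(* Let $G$ be a weakly closed graph. Then $\mathrm{v}(J_G)\le \mathrm{v}(\mathrm{in}_<(J_G))$.
   Context: Let $K$ be a field, $G$ a finite simple graph on $V(G)=[n]=\{1,\dots,n\}$, and $S=K[x_1,\dots,x_n,y_1,\dots,y_n]$ with the standard grading. The binomial edge ideal of $G$ is $J_G=\langle x_iy_j-x_jy_i\mid\{i,j\}\in E(G),\ i<j\rangle$. The monomial order $<$ on $S$ is the lexicographic order induced by $x_1>\cdots>x_n>y_1>\cdots>y_n$, and $\mathrm{in}_<(J_G)$ is the initial ideal of $J_G$ with respect to $<$. A graph on $n$ vertices is weakly closed if its vertices can be labelled by $[n]$ so that for every edge $\{i,j\}$ with $j>i+1$ and every $k$ with $i<k<j$, at least one of $\{i,k\}$, $\{k,j\}$ is an edge. For a proper graded ideal $I$ of $S$, $\mathrm{Ass}(I)$ is the set of associated primes of $S/I$, $S_d$ is the degree $d$ component of $S$, and $\mathrm{v}(I)=\min\{d\ge 0\mid \exists f\in S_d\text{ and }\mathfrak p\in\mathrm{Ass}(I)\text{ with }(I:f)=\mathfrak p\}$.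
   Formalization: The vertex labelling used to form J_G and its initial ideal is required to be one that witnesses weak closedness; for an arbitrary labelling of a weakly closed graph the inequality can fail (e.g. a suitably labelled path on 7 vertices). *)

theory Defs
  imports "HOL-Algebra.Ideal" "HOL-Library.Poly_Mapping"
begin

section \<open>Graphs and labellings\<close>

definition simple_graph :: "'v set \<Rightarrow> 'v set set \<Rightarrow> bool" where
  "simple_graph V E \<longleftrightarrow> finite V \<and> (\<forall>e\<in>E. e \<subseteq> V \<and> card e = 2)"

definition relabel :: "('v \<Rightarrow> nat) \<Rightarrow> 'v set set \<Rightarrow> nat set set" where
  "relabel \<phi> E = (\<lambda>e. \<phi> ` e) ` E"

definition weakly_closed_labelling :: "'v set \<Rightarrow> 'v set set \<Rightarrow> ('v \<Rightarrow> nat) \<Rightarrow> bool" where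
  "weakly_closed_labelling V E \<phi> \<longleftrightarrow>
     bij_betw \<phi> V {1..card V} \<and>
     (\<forall>i j. {i, j} \<in> relabel \<phi> E \<and> j > i + 1 \<longrightarrow>
        (\<forall>k. i < k \<and> k < j \<longrightarrow> {i, k} \<in> relabel \<phi> E \<or> {k, j} \<in> relabel \<phi> E))"

text \<open>
  Being weakly closed is a property of the unlabelled graph, but the initial ideal depends on how
  the vertices are identified with \<open>{1..n}\<close>; a weakly closed graph is therefore used
  together with a labelling that witnesses this property.
\<close>

definition weakly_closed :: "'v set \<Rightarrow> 'v set set \<Rightarrow> bool" where
  "weakly_closed V E \<longleftrightarrow> (\<exists>\<phi>. weakly_closed_labelling V E \<phi>)"


section \<open>The polynomial ring and its lexicographic order\<close>

datatype var = X nat | Y nat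

text \<open>
  The order on variables is \<open>X 1 < X 2 < \<dots> < Y 1 < Y 2 < \<dots>\<close>. The library order on finitely
  supported functions compares exponents at the \<^emph>\<open>least\<close> argument where they differ. On
  monomials it is therefore the lexicographic order with
  \<open>x\<^sub>1 > x\<^sub>2 > \<dots> > y\<^sub>1 > y\<^sub>2 > \<dots>\<close>, the reverse of the order on \<open>var\<close>; see
  \<open>monomial_less_iff\<close> and \<open>single_less_single_iff\<close> below.
\<close>

instantiation var :: linorder
begin

fun less_var :: "var \<Rightarrow> var \<Rightarrow> bool" where
  "less_var (X i) (X j) \<longleftrightarrow> i < j"
| "less_var (X i) (Y j) \<longleftrightarrow> True"
| "less_var (Y i) (X j) \<longleftrightarrow> False"
| "less_var (Y i) (Y j) \<longleftrightarrow> i < j"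

definition less_eq_var :: "var \<Rightarrow> var \<Rightarrow> bool" where
  "less_eq_var v w \<longleftrightarrow> v < w \<or> v = w"

instance
proof
  fix u v w :: var
  show "v < w \<longleftrightarrow> v \<le> w \<and> \<not> w \<le> v"
    by (cases v; cases w) (auto simp: less_eq_var_def)
  show "v \<le> v"
    by (simp add: less_eq_var_def)
  show "u \<le> v \<Longrightarrow> v \<le> w \<Longrightarrow> u \<le> w"
    by (cases u; cases v; cases w) (auto simp: less_eq_var_def)
  show "v \<le> w \<Longrightarrow> w \<le> v \<Longrightarrow> v = w"
    by (cases v; cases w) (auto simp: less_eq_var_def)
  show "v \<le> w \<or> w \<le> v"
    by (cases v; cases w) (auto simp: less_eq_var_def)
qed

end

type_synonym monomial = "var \<Rightarrow>\<^sub>0 nat"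
type_synonym 'k mpoly = "monomial \<Rightarrow>\<^sub>0 'k"

lemma monomial_less_iff:
  fixes s t :: monomial
  shows "s < t \<longleftrightarrow>
    (\<exists>v. Poly_Mapping.lookup s v < Poly_Mapping.lookup t v \<and>
         (\<forall>w<v. Poly_Mapping.lookup s w = Poly_Mapping.lookup t w))"
  by (simp add: less_poly_mapping.rep_eq less_fun_def)

lemma single_less_single_iff:
  "(Poly_Mapping.single v 1 :: monomial) < Poly_Mapping.single w 1 \<longleftrightarrow> w < v"
proof -
  have *: "(Poly_Mapping.single v 1 :: monomial) < Poly_Mapping.single w 1" if "w < v" for v w :: var
    unfolding monomial_less_iff
    by (rule exI[of _ w]) (use that in \<open>auto simp: lookup_single when_def\<close>)
  show ?thesis
    using *[of w v] *[of v w] less_asym by (metis linorder_cases less_irrefl)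
qed

definition variables :: "nat \<Rightarrow> var set" where
  "variables n = X ` {1..n} \<union> Y ` {1..n}"

text \<open>
  The ring \<open>K[x\<^sub>1,\<dots>,x\<^sub>n,y\<^sub>1,\<dots>,y\<^sub>n]\<close>, carried by those polynomials over the
  infinite set of variables \<open>var\<close> in which only \<open>variables n\<close> occur.
\<close>

definition poly_ring :: "nat \<Rightarrow> ('k::field) mpoly ring" where
  "poly_ring n =
     \<lparr>carrier = {f. \<forall>m\<in>Poly_Mapping.keys f. Poly_Mapping.keys m \<subseteq> variables n},
      mult = (*), one = 1, zero = 0, add = (+)\<rparr>"

lemma cring_poly_ring: "cring (poly_ring n :: ('k::field) mpoly ring)"
proof (intro cringI abelian_groupI comm_monoidI)
  fix f g :: "'k mpoly"
  assume fg: "f \<in> carrier (poly_ring n)" "g \<in> carrier (poly_ring n)"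
  show "f \<oplus>\<^bsub>poly_ring n\<^esub> g \<in> carrier (poly_ring n)"
    using fg Poly_Mapping.keys_add[of f g] by (auto simp: poly_ring_def)
  show "f \<otimes>\<^bsub>poly_ring n\<^esub> g \<in> carrier (poly_ring n)"
  proof -
    have "Poly_Mapping.keys m \<subseteq> variables n" if m: "m \<in> Poly_Mapping.keys (f * g)" for m
    proof -
      obtain a b where "m = a + b" "a \<in> Poly_Mapping.keys f" "b \<in> Poly_Mapping.keys g"
        using m keys_mult[of f g] by blast
      then show ?thesis
        using fg Poly_Mapping.keys_add[of a b] unfolding poly_ring_def by fastforce
    qed
    then show ?thesis
      by (simp add: poly_ring_def)
  qed
next
  fix f :: "'k mpoly"
  assume "f \<in> carrier (poly_ring n)"
  then show "\<exists>g\<in>carrier (poly_ring n). g \<oplus>\<^bsub>poly_ring n\<^esub> f = \<zero>\<^bsub>poly_ring n\<^esub>"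
    by (intro bexI[of _ "- f"]) (auto simp: poly_ring_def)
qed (auto simp: poly_ring_def algebra_simps)

definition monomial_poly :: "monomial \<Rightarrow> ('k::field) mpoly" where
  "monomial_poly m = Poly_Mapping.single m 1"

definition var_poly :: "var \<Rightarrow> ('k::field) mpoly" where
  "var_poly v = monomial_poly (Poly_Mapping.single v 1)"

definition monomial_degree :: "monomial \<Rightarrow> nat" where
  "monomial_degree m = (\<Sum>v\<in>Poly_Mapping.keys m. Poly_Mapping.lookup m v)"

text \<open>The graded component \<open>S\<^sub>d\<close>, which contains \<open>0\<close>.\<close>

definition graded_component :: "nat \<Rightarrow> nat \<Rightarrow> ('k::field) mpoly set" where
  "graded_component n d =
     {f \<in> carrier (poly_ring n). \<forall>m\<in>Poly_Mapping.keys f. monomial_degree m = d}"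

text \<open>Meaningful only for \<open>f \<noteq> 0\<close>.\<close>

definition leading_monomial :: "('k::field) mpoly \<Rightarrow> monomial" where
  "leading_monomial f = Max (Poly_Mapping.keys f)"

definition initial_ideal :: "nat \<Rightarrow> ('k::field) mpoly set \<Rightarrow> 'k mpoly set" where
  "initial_ideal n I =
     Idl\<^bsub>poly_ring n\<^esub> {monomial_poly (leading_monomial f) | f. f \<in> I \<and> f \<noteq> 0}"


section \<open>Binomial edge ideals and the v-number\<close>

definition binomial_edge_ideal :: "nat \<Rightarrow> nat set set \<Rightarrow> ('k::field) mpoly set" where
  "binomial_edge_ideal n E =
     Idl\<^bsub>poly_ring n\<^esub>
       {var_poly (X i) * var_poly (Y j) - var_poly (X j) * var_poly (Y i) | i j.
          {i, j} \<in> E \<and> i < j}"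

definition colon_ideal :: "nat \<Rightarrow> ('k::field) mpoly set \<Rightarrow> 'k mpoly \<Rightarrow> 'k mpoly set" where
  "colon_ideal n I f = {g \<in> carrier (poly_ring n). g * f \<in> I}"

text \<open>The annihilator of the class of \<open>f\<close> in \<open>S/I\<close> is the colon ideal \<open>(I : f)\<close>.\<close>

definition associated_primes :: "nat \<Rightarrow> ('k::field) mpoly set \<Rightarrow> 'k mpoly set set" where
  "associated_primes n I =
     {P. primeideal P (poly_ring n) \<and> (\<exists>f\<in>carrier (poly_ring n). P = colon_ideal n I f)}"

text \<open>
  For a proper graded ideal the set of admissible degrees is nonempty, so \<open>LEAST\<close> is its minimum.
\<close>

definition v_number :: "nat \<Rightarrow> ('k::field) mpoly set \<Rightarrow> nat" where
  "v_number n I =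
     (LEAST d. \<exists>f\<in>graded_component n d. \<exists>P\<in>associated_primes n I. colon_ideal n I f = P)"

end

theory Submission
  imports Defs
begin

text \<open>
  For \<open>W \<subseteq> {1..n}\<close> let \<open>P W\<close> (\<open>component_prime n E W\<close>) be the prime generated by the variables
  \<open>x\<^sub>i, y\<^sub>i\<close> with \<open>i \<notin> W\<close> and by all minors \<open>x\<^sub>i y\<^sub>j - x\<^sub>j y\<^sub>i\<close> with \<open>i\<close> and \<open>j\<close> in the same
  connected component of the induced graph on \<open>W\<close>. The binomial edge ideal \<open>J\<close> is the intersection
  of these primes. If \<open>(in(J) : f)\<close> is prime, with \<open>f\<close> homogeneous of degree \<open>d\<close>, a polynomial \<open>b\<close> of
  the same degree is wanted for which \<open>(J : b)\<close> is prime.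
  
  The point is that taking initial ideals commutes with intersecting the primes \<open>P W\<close>. This holds
  because one family of polynomials serves all of them at once: every monomial \<open>m\<close> is the leading
  monomial of a polynomial \<open>b\<close> that lies in \<open>P W\<close> for each \<open>W\<close> with \<open>m \<in> in(P W)\<close>. To construct it,
  read the letters of \<open>m\<close> column by column, in each column \<open>i\<close> the factors \<open>y\<^sub>i\<close>, as closing
  brackets, before the factors \<open>x\<^sub>i\<close>, as opening brackets. Then \<open>b\<close> (\<open>bracket_poly m b\<close>) is the
  product of the minors of the matched pairs and of the unmatched letters. In a weakly closed
  labelling the components of the graph on \<open>W\<close> are consecutive blocks of \<open>W\<close>
  (\<open>linked_convex\<close>). If \<open>m\<close> has a letter in a column outside \<open>W\<close>, then so has every monomial of \<open>b\<close>,
  and \<open>b \<in> P W\<close>. Otherwise \<open>m \<in> in(P W)\<close> has an opening bracket and a later closing bracket in the same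
  block. Between an opening bracket and a later closing bracket of the same block there
  are adjacent ones, which are matched, so that \<open>b\<close> has a factor in \<open>P W\<close>
  (\<open>bracket_poly_in_component_prime\<close>). The argument holds over every field, and it yields
  \<open>b \<in> J\<close> whenever \<open>m\<close> lies in all \<open>in(P W)\<close>; reduction by these polynomials then shows that
  \<open>J\<close> is the intersection of the \<open>P W\<close> and computes \<open>in(J)\<close>
  (\<open>component_primes_Int_subset_edge_ideal\<close>, \<open>initial_edge_ideal_iff\<close>).
  
  Let now \<open>(in(J) : f)\<close> be prime. As \<open>in(J)\<close> is the intersection of the finitely many \<open>in(P W)\<close>,
  prime avoidance gives some \<open>W\<close> and a monomial \<open>m\<close> of \<open>f\<close> with \<open>m \<notin> in(P W)\<close> and
  \<open>in(P W) m \<subseteq> in(J)\<close> (\<open>initial_ideal_prime_colon\<close>). Comparing blocks shows that \<open>P W \<subseteq> P W'\<close> for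
  every \<open>W'\<close> with \<open>m \<notin> in(P W')\<close> (\<open>in_initial_mono_of_colon\<close>). For the polynomial \<open>b\<close> belonging to \<open>m\<close>
  this means that \<open>(J : b)\<close>, the intersection of the \<open>P W'\<close> with \<open>b \<notin> P W'\<close>, equals the prime \<open>P W\<close>
  (\<open>edge_ideal_colon\<close>), and \<open>b\<close> has the degree of \<open>f\<close>. For the least element in the definition
  of the v-number to be a genuine minimum, \<open>in(J)\<close> must have an associated prime that is the colon
  ideal of a homogeneous element; a maximal squarefree monomial outside \<open>in(J)\<close> provides one
  (\<open>initial_ideal_has_associated_prime\<close>).
\<close>

section \<open>Polynomials and ideals\<close>

abbreviation lookup :: "('a \<Rightarrow>\<^sub>0 'b::zero) \<Rightarrow> 'a \<Rightarrow> 'b" where "lookup \<equiv> Poly_Mapping.lookup"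
abbreviation keys :: "('a \<Rightarrow>\<^sub>0 'b::zero) \<Rightarrow> 'a set" where "keys \<equiv> Poly_Mapping.keys"
abbreviation single :: "'a \<Rightarrow> 'b \<Rightarrow> 'a \<Rightarrow>\<^sub>0 'b::zero" where "single \<equiv> Poly_Mapping.single"

(* Variables are the monomials with the exponent numeral 1, which has to survive simplification. *)
declare One_nat_def [simp del]

abbreviation var_monomial :: "var \<Rightarrow> monomial" where "var_monomial v \<equiv> single v 1"

definition monomials :: "nat \<Rightarrow> monomial set" where
  "monomials n = {m. keys m \<subseteq> variables n}"

lemma keys_monomial_add: "keys (s + t) = keys s \<union> keys (t :: monomial)"
  by (auto simp: in_keys_iff lookup_add)

lemma monomials_add_iff: "s + t \<in> monomials n \<longleftrightarrow> s \<in> monomials n \<and> t \<in> monomials n"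
  by (simp add: monomials_def keys_monomial_add)

lemma monomials_zero [simp]: "0 \<in> monomials n"
  by (simp add: monomials_def)

lemma carrier_iff: "f \<in> carrier (poly_ring n) \<longleftrightarrow> keys f \<subseteq> monomials n"
  by (auto simp: poly_ring_def monomials_def)

lemma poly_ring_simps [simp]:
  "f \<otimes>\<^bsub>poly_ring n\<^esub> g = f * g" "f \<oplus>\<^bsub>poly_ring n\<^esub> g = f + g"
  "\<zero>\<^bsub>poly_ring n\<^esub> = 0" "\<one>\<^bsub>poly_ring n\<^esub> = 1"
  by (simp_all add: poly_ring_def)

lemma carrier_zero: "0 \<in> carrier (poly_ring n)"
  by (simp add: carrier_iff)

lemma carrier_add:
  "f \<in> carrier (poly_ring n) \<Longrightarrow> g \<in> carrier (poly_ring n) \<Longrightarrow> f + g \<in> carrier (poly_ring n)"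
  using Poly_Mapping.keys_add[of f g] by (auto simp: carrier_iff)

lemma carrier_mult:
  assumes "f \<in> carrier (poly_ring n)" "g \<in> carrier (poly_ring n)"
  shows "f * g \<in> carrier (poly_ring n :: ('k::field) mpoly ring)"
proof -
  interpret cring "poly_ring n :: 'k mpoly ring" by (rule cring_poly_ring)
  show ?thesis using m_closed[OF assms] by simp
qed

lemma keys_uminus: "keys (- f) = keys (f :: ('a, 'b::ab_group_add) poly_mapping)"
  by (auto simp: in_keys_iff)

lemma carrier_minus:
  "f \<in> carrier (poly_ring n) \<Longrightarrow> g \<in> carrier (poly_ring n) \<Longrightarrow> f - g \<in> carrier (poly_ring n)"
  using carrier_add[of f n "- g"] by (simp add: carrier_iff keys_uminus)

lemma carrier_single: "m \<in> monomials n \<Longrightarrow> single m c \<in> carrier (poly_ring n)"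
  by (auto simp: carrier_iff)

lemma ideal_poly_ringI:
  fixes I :: "('k::field) mpoly set"
  assumes "I \<subseteq> carrier (poly_ring n)" "0 \<in> I" "\<And>f g. f \<in> I \<Longrightarrow> g \<in> I \<Longrightarrow> f + g \<in> I"
    and mult: "\<And>f g. f \<in> carrier (poly_ring n) \<Longrightarrow> g \<in> I \<Longrightarrow> f * g \<in> I"
  shows "ideal I (poly_ring n)"
proof -
  interpret cring "poly_ring n :: 'k mpoly ring" by (rule cring_poly_ring)
  have neg: "- f \<in> I" if "f \<in> I" for f
    using mult[of "- 1" f] that by (auto simp: carrier_iff keys_uminus)
  have inv: "inv\<^bsub>add_monoid (poly_ring n)\<^esub> f = - f" if "f \<in> I" for f
    using that assms(1) neg[OF that] by (intro minus_equality[unfolded a_inv_def]) auto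
  show ?thesis
  proof (rule idealI)
    show "subgroup I (add_monoid (poly_ring n))"
      using assms neg inv by unfold_locales auto
    show "f \<otimes>\<^bsub>poly_ring n\<^esub> g \<in> I" if "f \<in> I" "g \<in> carrier (poly_ring n)" for f g
      using mult[of g f] that by (simp add: mult.commute)
  qed (use mult ring_axioms in auto)
qed

lemma ideal_subset: "ideal I (poly_ring n) \<Longrightarrow> I \<subseteq> carrier (poly_ring n)"
  by (meson ideal.Icarr subsetI)

lemma ideal_zero: "ideal I (poly_ring n) \<Longrightarrow> 0 \<in> I"
  by (metis additive_subgroup.zero_closed ideal.axioms(1) poly_ring_simps(3))

lemma ideal_add: "ideal I (poly_ring n) \<Longrightarrow> f \<in> I \<Longrightarrow> g \<in> I \<Longrightarrow> f + g \<in> I"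
  by (metis additive_subgroup.a_closed ideal.axioms(1) poly_ring_simps(2))

lemma ideal_mult: "ideal I (poly_ring n) \<Longrightarrow> f \<in> carrier (poly_ring n) \<Longrightarrow> g \<in> I \<Longrightarrow> f * g \<in> I"
  by (metis ideal.I_l_closed poly_ring_simps(1))

lemma ideal_diff: 
  assumes "ideal I (poly_ring n)" "f \<in> I" "g \<in> I" shows "f - g \<in> I"
  using ideal_add[OF assms(1,2) ideal_mult[OF assms(1) _ assms(3), of "- 1"]]
  by (simp add: carrier_iff keys_uminus)

lemma ideal_sum:
  assumes "ideal I (poly_ring n)" "\<And>x. x \<in> A \<Longrightarrow> f x \<in> I" shows "sum f A \<in> I"
  using assms(2) by (induction A rule: infinite_finite_induct) 
    (auto intro: ideal_zero[OF assms(1)] ideal_add[OF assms(1)])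

lemma ideal_carrier_Int:
  fixes P :: "'a \<Rightarrow> ('k::field) mpoly set"
  assumes "\<And>W. W \<in> F \<Longrightarrow> ideal (P W) (poly_ring n)"
  shows "ideal {f \<in> carrier (poly_ring n). \<forall>W\<in>F. f \<in> P W} (poly_ring n)"
  by (rule ideal_poly_ringI)
    (auto simp: carrier_zero carrier_add carrier_mult intro: ideal_zero ideal_add ideal_mult assms)

lemma sum_terms: "(\<Sum>k\<in>keys f. single k (lookup f k)) = f"
  by (rule poly_mapping_eqI) (auto simp: lookup_sum lookup_single when_def in_keys_iff)

section \<open>Kernels of monomial substitutions\<close>

definition monomial_subst :: "(var \<Rightarrow> monomial) \<Rightarrow> monomial \<Rightarrow> monomial" where
  "monomial_subst \<theta> k = (\<Sum>v\<in>keys k. Poly_Mapping.map ((*) (lookup k v)) (\<theta> v))"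

lemma lookup_monomial_subst:
  assumes "finite A" "keys k \<subseteq> A"
  shows "lookup (monomial_subst \<theta> k) w = (\<Sum>v\<in>A. lookup k v * lookup (\<theta> v) w)"
proof -
  have "lookup (monomial_subst \<theta> k) w = (\<Sum>v\<in>keys k. lookup k v * lookup (\<theta> v) w)"
    by (auto simp: monomial_subst_def lookup_sum Poly_Mapping.map.rep_eq when_def intro!: sum.cong)
  also have "\<dots> = (\<Sum>v\<in>A. lookup k v * lookup (\<theta> v) w)"
    using assms by (intro sum.mono_neutral_left) (auto simp: in_keys_iff)
  finally show ?thesis .
qed

lemma monomial_subst_add: "monomial_subst \<theta> (s + t) = monomial_subst \<theta> s + monomial_subst \<theta> t"
  by (rule poly_mapping_eqI)
    (simp add: lookup_monomial_subst[of "keys s \<union> keys t"] keys_monomial_add lookup_add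
      sum.distrib[symmetric] distrib_right)

text \<open>
  The ring homomorphism that sends the variables in \<open>Z\<close> to \<open>0\<close> and every other variable \<open>v\<close> to the
  monomial \<open>\<theta> v\<close>.
\<close>

definition poly_subst :: "var set \<Rightarrow> (var \<Rightarrow> monomial) \<Rightarrow> ('k::field) mpoly \<Rightarrow> 'k mpoly" where
  "poly_subst Z \<theta> f = (\<Sum>k\<in>keys f. if keys k \<inter> Z = {} then single (monomial_subst \<theta> k) (lookup f k) else 0)"

lemma poly_subst_superset:
  assumes "finite A" "keys f \<subseteq> A"
  shows "poly_subst Z \<theta> f = (\<Sum>k\<in>A. if keys k \<inter> Z = {} then single (monomial_subst \<theta> k) (lookup f k) else 0)"
  unfolding poly_subst_def using assms by (intro sum.mono_neutral_left) (auto simp: in_keys_iff)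

lemma poly_subst_zero [simp]: "poly_subst Z \<theta> 0 = 0"
  by (simp add: poly_subst_def)

lemma poly_subst_add: "poly_subst Z \<theta> (f + g) = poly_subst Z \<theta> f + poly_subst Z \<theta> g"
  using Poly_Mapping.keys_add[of f g]
  by (auto simp: poly_subst_superset[of "keys f \<union> keys g"] lookup_add single_add
      sum.distrib[symmetric] intro!: sum.cong)

lemma poly_subst_sum: "poly_subst Z \<theta> (sum F A) = (\<Sum>x\<in>A. poly_subst Z \<theta> (F x))"
  by (induction A rule: infinite_finite_induct) (auto simp: poly_subst_add)

lemma poly_subst_single:
  "poly_subst Z \<theta> (single k c) = (if keys k \<inter> Z = {} then single (monomial_subst \<theta> k) c else 0)"
  by (simp add: poly_subst_def)

lemma poly_subst_mult: "poly_subst Z \<theta> (f * g) = poly_subst Z \<theta> f * poly_subst Z \<theta> g"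
proof -
  have "f * g = (\<Sum>k\<in>keys f. \<Sum>l\<in>keys g. single (k + l) (lookup f k * lookup g l))"
    using arg_cong2[of _ _ _ _ "(*)", OF sum_terms[of f] sum_terms[of g]]
    by (simp add: sum_product mult_single)
  also have "poly_subst Z \<theta> \<dots> = (\<Sum>k\<in>keys f. \<Sum>l\<in>keys g. 
      poly_subst Z \<theta> (single k (lookup f k)) * poly_subst Z \<theta> (single l (lookup g l)))"
    by (auto simp: poly_subst_sum poly_subst_single keys_monomial_add monomial_subst_add mult_single
        intro!: sum.cong)
  also have "\<dots> = poly_subst Z \<theta> f * poly_subst Z \<theta> g"
    by (simp only: sum_product[symmetric] poly_subst_sum[symmetric] sum_terms)
  finally show ?thesis .
qed

definition subst_kernel :: "nat \<Rightarrow> var set \<Rightarrow> (var \<Rightarrow> monomial) \<Rightarrow> ('k::field) mpoly set" where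
  "subst_kernel n Z \<theta> = {f \<in> carrier (poly_ring n). poly_subst Z \<theta> f = 0}"

text \<open>
  The target of the substitution is a polynomial ring over a field, hence a domain.
\<close>

lemma subst_kernel_prime:
  "primeideal (subst_kernel n Z \<theta> :: ('k::field) mpoly set) (poly_ring n)"
proof (rule primeidealI)
  show "ideal (subst_kernel n Z \<theta> :: 'k mpoly set) (poly_ring n)"
    by (rule ideal_poly_ringI)
      (simp_all add: subst_kernel_def carrier_zero carrier_add carrier_mult poly_subst_add poly_subst_mult subset_iff)
  have "poly_subst Z \<theta> 1 = (1 :: 'k mpoly)"
    using poly_subst_single[of Z \<theta> 0 "1::'k"] by (simp add: monomial_subst_def)
  then have "1 \<notin> (subst_kernel n Z \<theta> :: 'k mpoly set)"
    by (simp add: subst_kernel_def)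
  moreover have "(1 :: 'k mpoly) \<in> carrier (poly_ring n)"
    by (simp add: carrier_iff)
  ultimately show "carrier (poly_ring n) \<noteq> (subst_kernel n Z \<theta> :: 'k mpoly set)"
    by blast
  fix f g :: "'k mpoly"
  assume fg: "f \<in> carrier (poly_ring n)" "g \<in> carrier (poly_ring n)"
    "f \<otimes>\<^bsub>poly_ring n\<^esub> g \<in> subst_kernel n Z \<theta>"
  then have "poly_subst Z \<theta> f * poly_subst Z \<theta> g = 0"
    by (simp add: subst_kernel_def poly_subst_mult)
  then have "poly_subst Z \<theta> f = 0 \<or> poly_subst Z \<theta> g = 0"
    by (rule mult_eq_0_iff[THEN iffD1])
  with fg show "f \<in> subst_kernel n Z \<theta> \<or> g \<in> subst_kernel n Z \<theta>"
    unfolding subst_kernel_def by blast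
qed (rule cring_poly_ring)

section \<open>Leading monomials and reduction\<close>

definition monic_at :: "monomial \<Rightarrow> ('k::field) mpoly \<Rightarrow> bool" where
  "monic_at m f \<longleftrightarrow> lookup f m = 1 \<and> (\<forall>k\<in>keys f. k \<le> m)"

lemma monic_at_nonzero: "monic_at m f \<Longrightarrow> f \<noteq> 0"
  by (auto simp: monic_at_def)

lemma monic_at_leading_monomial:
  assumes "monic_at m f"
  shows "leading_monomial f = m"
  using assms unfolding monic_at_def leading_monomial_def
  by (intro Max_eqI) (auto simp: in_keys_iff)

lemma leading_monomial_in_keys: "f \<noteq> 0 \<Longrightarrow> leading_monomial f \<in> keys f"
  unfolding leading_monomial_def by (intro Max_in) auto

lemma keys_le_leading_monomial: "k \<in> keys f \<Longrightarrow> k \<le> leading_monomial f"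
  unfolding leading_monomial_def by simp

text \<open>
  The variables form a \<open>2 \<times> n\<close> matrix whose \<open>i\<close>-th column consists of \<open>x\<^sub>i\<close> and \<open>y\<^sub>i\<close>. All
  generators of the ideals below are homogeneous for the grading by columns.
\<close>

definition column_degree :: "monomial \<Rightarrow> nat \<Rightarrow> nat" where
  "column_degree m i = lookup m (X i) + lookup m (Y i)"

fun column :: "var \<Rightarrow> nat" where
  "column (X i) = i"
| "column (Y i) = i"

abbreviation columns :: "monomial \<Rightarrow> nat set" where
  "columns m \<equiv> column ` keys m"

lemma in_columns_iff: "i \<in> columns m \<longleftrightarrow> X i \<in> keys m \<or> Y i \<in> keys m"
proof
  assume "i \<in> columns m"
  then obtain v where "v \<in> keys m" "column v = i" by blast
  then show "X i \<in> keys m \<or> Y i \<in> keys m" by (cases v) auto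
qed force

lemma in_columns_iff_degree: "i \<in> columns m \<longleftrightarrow> column_degree m i \<noteq> 0"
  unfolding in_columns_iff by (auto simp: column_degree_def in_keys_iff)

lemma columns_cong: "column_degree k = column_degree m \<Longrightarrow> columns k = columns m"
proof (rule Set.set_eqI)
  fix i assume "column_degree k = column_degree m"
  then show "i \<in> columns k \<longleftrightarrow> i \<in> columns m"
    using in_columns_iff_degree[of i k] in_columns_iff_degree[of i m] by simp
qed

lemma columns_add: "columns (s + t) = columns s \<union> columns t"
  by (simp add: keys_monomial_add image_Un)

lemma column_degree_add: "column_degree (s + t) = (\<lambda>i. column_degree s i + column_degree t i)"
  by (auto simp: column_degree_def lookup_add)

lemma keys_subset_columns: "keys m \<subseteq> X ` columns m \<union> Y ` columns m"
proof
  fix v assume "v \<in> keys m"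
  then have "column v \<in> columns m" by blast
  then show "v \<in> X ` columns m \<union> Y ` columns m" by (cases v) auto
qed

lemma sum_over_columns:
  fixes g :: "var \<Rightarrow> nat"
  assumes "finite C"
  shows "(\<Sum>v\<in>X ` C \<union> Y ` C. g v) = (\<Sum>i\<in>C. g (X i)) + (\<Sum>i\<in>C. g (Y i))"
  using assms by (subst sum.union_disjoint) (auto simp: sum.reindex inj_on_def)

lemma monomial_degree_columns: "monomial_degree m = (\<Sum>i\<in>columns m. column_degree m i)"
proof -
  have "monomial_degree m = (\<Sum>v\<in>X ` columns m \<union> Y ` columns m. lookup m v)"
    unfolding monomial_degree_def
    by (rule sum.mono_neutral_left) (use keys_subset_columns[of m] in \<open>auto simp: in_keys_iff\<close>)
  then show ?thesis
    by (simp add: sum_over_columns sum.distrib column_degree_def)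
qed

lemma monomials_iff_columns: "m \<in> monomials n \<longleftrightarrow> columns m \<subseteq> {1..n}"
proof -
  have "v \<in> variables n \<longleftrightarrow> column v \<in> {1..n}" for v
    by (cases v) (auto simp: variables_def)
  then show ?thesis by (auto simp: monomials_def)
qed

lemma finite_same_column_degree: "finite {k. column_degree k = column_degree m}"
proof -
  let ?A = "X ` columns m \<union> Y ` columns m"
  let ?S = "{k. column_degree k = column_degree m}"
  have A: "keys k \<subseteq> ?A" if "k \<in> ?S" for k
    using that keys_subset_columns[of k] columns_cong[of k m] by simp
  have "(\<lambda>k. restrict (lookup k) ?A) ` ?S \<subseteq> PiE ?A (\<lambda>v. {..column_degree m (column v)})"
  proof
    fix F assume "F \<in> (\<lambda>k. restrict (lookup k) ?A) ` ?S"
    then obtain k where k: "column_degree k = column_degree m" and F: "F = restrict (lookup k) ?A"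
      by blast
    have "lookup k v \<le> column_degree m (column v)" for v
      unfolding k[symmetric] by (cases v) (simp_all add: column_degree_def)
    then show "F \<in> PiE ?A (\<lambda>v. {..column_degree m (column v)})"
      unfolding F by (simp add: restrict_PiE_iff)
  qed
  then have "finite ((\<lambda>k. restrict (lookup k) ?A) ` ?S)"
    by (rule finite_subset) (auto intro!: finite_PiE)
  moreover have "inj_on (\<lambda>k. restrict (lookup k) ?A) ?S"
  proof (rule inj_onI, rule poly_mapping_eqI)
    fix k l v
    assume kl: "k \<in> ?S" "l \<in> ?S" and eq: "restrict (lookup k) ?A = restrict (lookup l) ?A"
    show "lookup k v = lookup l v"
    proof (cases "v \<in> ?A")
      case True
      then show ?thesis using fun_cong[OF eq, of v] by (simp only: restrict_apply if_True)
    next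
      case False
      then have "v \<notin> keys k" "v \<notin> keys l" using A kl by blast+
      then show ?thesis by (simp add: in_keys_iff)
    qed
  qed
  ultimately show ?thesis by (rule finite_imageD)
qed

text \<open>
  Division with remainder: the leading term of an element of \<open>I\<close> is cancelled by a multiple of an
  element of \<open>I \<inter> J\<close>. Since the column degrees are preserved, only finitely many monomials ever occur,
  and the process stops.
\<close>

lemma leading_monomial_reduction:
  fixes I J :: "('k::field) mpoly set"
  assumes I: "ideal I (poly_ring n)" and J: "ideal J (poly_ring n)"
    and lead: "\<And>f. f \<in> I \<Longrightarrow> f \<noteq> 0 \<Longrightarrow> M (leading_monomial f)"
    and basis: "\<And>m. m \<in> monomials n \<Longrightarrow> M m \<Longrightarrow>
      \<exists>b\<in>I \<inter> J. monic_at m b \<and> (\<forall>k\<in>keys b. column_degree k = column_degree m)"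
  shows "I \<subseteq> J"
proof
  fix f assume f: "f \<in> I"
  define D where "D = (\<Union>m\<in>keys f. {k. column_degree k = column_degree m})"
  have finD: "finite D"
    unfolding D_def by (auto intro: finite_same_column_degree)
  have "g \<in> J" if "g \<in> I" "keys g \<subseteq> D" for g
    using that
  proof (induction "card {k\<in>D. k \<le> leading_monomial g}" arbitrary: g rule: less_induct)
    case less
    show ?case
    proof (cases "g = 0")
      case True
      then show ?thesis using ideal_zero[OF J] by simp
    next
      case False
      define m c where "m = leading_monomial g" and "c = lookup g m"
      have m: "m \<in> keys g"
        unfolding m_def using False by (rule leading_monomial_in_keys)
      have "keys g \<subseteq> monomials n"
        using ideal_subset[OF I] less.prems(1) carrier_iff by blast
      then obtain b where b: "b \<in> I" "b \<in> J" "monic_at m b"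
        "\<And>k. k \<in> keys b \<Longrightarrow> column_degree k = column_degree m"
        using basis[of m] lead[OF less.prems(1) False] m by (auto simp: m_def)
      define s :: "'k mpoly" where "s = single 0 c"
      have s: "s \<in> carrier (poly_ring n)"
        unfolding s_def by (rule carrier_single) simp
      have lookup_sb: "lookup (s * b) k = c * lookup b k" for k
        unfolding s_def mult_map_scale_conv_mult[symmetric]
        by (simp add: Poly_Mapping.map.rep_eq when_def)
      define g' where "g' = g - s * b"
      have g': "g' \<in> I"
        unfolding g'_def using less.prems b s I by (intro ideal_diff ideal_mult) auto
      have lookup_g': "lookup g' k = lookup g k - c * lookup b k" for k
        by (simp add: g'_def lookup_minus lookup_sb)
      have keys_g': "k \<in> D \<and> k < m" if "k \<in> keys g'" for k
      proof
        have *: "k \<in> keys g \<or> k \<in> keys b"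
          using that by (auto simp: in_keys_iff lookup_g')
        show "k \<in> D"
          using * b(4) less.prems(2) m unfolding D_def by fastforce
        have "k \<le> m"
          using * b(3) by (auto simp: monic_at_def m_def intro: keys_le_leading_monomial)
        moreover have "k \<noteq> m"
          using that b(3) by (auto simp: in_keys_iff lookup_g' c_def monic_at_def)
        ultimately show "k < m" by simp
      qed
      have "g' \<in> J"
      proof (cases "g' = 0")
        case True
        then show ?thesis using ideal_zero[OF J] by simp
      next
        case False
        then have lt: "leading_monomial g' < m"
          using keys_g' leading_monomial_in_keys by blast
        show ?thesis
        proof (rule less.hyps)
          show "card {k\<in>D. k \<le> leading_monomial g'} < card {k\<in>D. k \<le> leading_monomial g}"
          proof (rule psubset_card_mono)
            have "m \<in> {k\<in>D. k \<le> leading_monomial g}" "m \<notin> {k\<in>D. k \<le> leading_monomial g'}"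
              using m less.prems(2) lt by (auto simp: m_def)
            then show "{k\<in>D. k \<le> leading_monomial g'} \<subset> {k\<in>D. k \<le> leading_monomial g}"
              using lt unfolding m_def by fastforce
          qed (use finD in auto)
        qed (use g' keys_g' in auto)
      qed
      then have "g' + s * b \<in> J"
        using b s J by (intro ideal_add ideal_mult) auto
      then show ?thesis by (simp add: g'_def)
    qed
  qed
  then show "f \<in> J"
    using f unfolding D_def by fastforce
qed

section \<open>Minors and bracket polynomials\<close>

definition minor :: "nat \<Rightarrow> nat \<Rightarrow> ('k::field) mpoly" where
  "minor i j = var_poly (X i) * var_poly (Y j) - var_poly (X j) * var_poly (Y i)"

lemma minor_swap: "minor j i = - minor i j"
  by (simp add: minor_def)

text \<open>
  Pluecker relations: a minor on the columns \<open>i\<close> and \<open>j\<close>, multiplied by a variable of column \<open>k\<close>,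
  can be routed through \<open>k\<close>.
\<close>

lemma minor_exchange:
  "var_poly (X k) * minor i j = var_poly (X i) * minor k j + var_poly (X j) * minor i k"
  "var_poly (Y k) * minor i j = var_poly (Y i) * minor k j + var_poly (Y j) * minor i k"
  by (simp_all add: minor_def algebra_simps)

lemma monomial_poly_mult: "monomial_poly s * monomial_poly t = monomial_poly (s + t)"
  by (simp add: monomial_poly_def mult_single)

lemma monomial_poly_zero: "monomial_poly 0 = 1"
  by (simp add: monomial_poly_def)

lemma minor_conv_monomials:
  "minor i j = monomial_poly (var_monomial (X i) + var_monomial (Y j))
     - monomial_poly (var_monomial (X j) + var_monomial (Y i))"
  by (simp add: minor_def var_poly_def monomial_poly_mult)

lemma carrier_monomial_poly: "m \<in> monomials n \<Longrightarrow> monomial_poly m \<in> carrier (poly_ring n)"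
  unfolding monomial_poly_def by (rule carrier_single)

lemma var_monomial_in_monomials: "var_monomial v \<in> monomials n \<longleftrightarrow> column v \<in> {1..n}"
  by (simp add: monomials_iff_columns)

lemma carrier_var_poly: "column v \<in> {1..n} \<Longrightarrow> var_poly v \<in> carrier (poly_ring n)"
  unfolding var_poly_def by (intro carrier_monomial_poly) (simp add: var_monomial_in_monomials)

lemma carrier_minor: "i \<in> {1..n} \<Longrightarrow> j \<in> {1..n} \<Longrightarrow> minor i j \<in> carrier (poly_ring n)"
  unfolding minor_def by (intro carrier_minus carrier_mult carrier_var_poly) auto

lemma lookup_monomial_poly_mult: "lookup (monomial_poly t * f) (t + k) = lookup f k"
proof -
  have "lookup (monomial_poly t * f) (t + k)
      = (\<Sum>l\<in>keys f. lookup (single (t + l) (lookup f l)) (t + k))"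
    using arg_cong[OF sum_terms[of f], of "\<lambda>g. lookup (monomial_poly t * g) (t + k)"]
    by (simp add: monomial_poly_def sum_distrib_left mult_single lookup_sum)
  also have "\<dots> = lookup f k"
    by (auto simp: lookup_single when_def in_keys_iff)
  finally show ?thesis .
qed

lemma keys_monomial_poly_mult: "keys (monomial_poly t * f) = (+) t ` keys f"
proof
  show "keys (monomial_poly t * f) \<subseteq> (+) t ` keys f"
    using keys_mult[of "monomial_poly t" f] by (auto simp: monomial_poly_def)
  show "(+) t ` keys f \<subseteq> keys (monomial_poly t * f)"
    by (auto simp: in_keys_iff lookup_monomial_poly_mult)
qed

lemma monic_at_minor_mult:
  assumes ij: "i < j" and f: "monic_at m f"
  shows "monic_at (var_monomial (X i) + var_monomial (Y j) + m) (minor i j * f)"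
proof -
  let ?s = "var_monomial (X i) + var_monomial (Y j)" and ?t = "var_monomial (X j) + var_monomial (Y i)"
  have ts: "?t < ?s"
    unfolding monomial_less_iff
  proof (intro exI[of _ "X i"] conjI allI impI)
    fix w assume "w < X i"
    then show "lookup ?t w = lookup ?s w"
      using ij by (cases w) (auto simp: lookup_add lookup_single when_def)
  qed (use ij in \<open>auto simp: lookup_add lookup_single when_def\<close>)
  have eq: "minor i j * f = monomial_poly ?s * f - monomial_poly ?t * f"
    by (simp add: minor_conv_monomials algebra_simps)
  have t_lt: "k < ?s + m" if "k \<in> keys (monomial_poly ?t * f)" for k
  proof -
    obtain l where "l \<in> keys f" "k = ?t + l" using \<open>k \<in> _\<close> keys_monomial_poly_mult by blast
    then show ?thesis using f ts by (auto simp: monic_at_def intro: add_less_le_mono)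
  qed
  have s_le: "k \<le> ?s + m" if "k \<in> keys (monomial_poly ?s * f)" for k
    using that keys_monomial_poly_mult[of ?s f] f by (auto simp: monic_at_def)
  have "lookup (minor i j * f) (?s + m) = 1"
    using t_lt[of "?s + m"] f
    by (auto simp: eq lookup_minus lookup_monomial_poly_mult monic_at_def in_keys_iff)
  moreover have "k \<le> ?s + m" if "k \<in> keys (minor i j * f)" for k
  proof -
    have "k \<in> keys (monomial_poly ?s * f) \<or> k \<in> keys (monomial_poly ?t * f)"
      using that by (auto simp: eq in_keys_iff lookup_minus)
    then show ?thesis using s_le t_lt by (auto intro: less_imp_le)
  qed
  ultimately show ?thesis by (auto simp: monic_at_def)
qed

text \<open>
  Both terms of a minor have the column degree of its leading monomial \<open>x\<^sub>i y\<^sub>j\<close>.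
\<close>

lemma keys_minor_mult:
  assumes "k \<in> keys (minor i j * f)"
  shows "\<exists>l\<in>keys f. column_degree k = column_degree (var_monomial (X i) + var_monomial (Y j) + l)"
proof -
  let ?s = "var_monomial (X i) + var_monomial (Y j)" and ?t = "var_monomial (X j) + var_monomial (Y i)"
  have eq: "minor i j * f = monomial_poly ?s * f - monomial_poly ?t * f"
    by (simp add: minor_conv_monomials algebra_simps)
  have "k \<in> keys (monomial_poly ?s * f) \<or> k \<in> keys (monomial_poly ?t * f)"
    using assms by (auto simp: eq in_keys_iff lookup_minus)
  then obtain l where "l \<in> keys f" "k = ?s + l \<or> k = ?t + l"
    using keys_monomial_poly_mult by blast
  then show ?thesis
    by (intro bexI[of _ l]) (auto simp: column_degree_def lookup_add lookup_single when_def)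
qed

text \<open>
  The rule \<open>bracket\<close> matches an opening bracket \<open>x\<^sub>i\<close> with a closing bracket \<open>y\<^sub>j\<close> that are adjacent in
  the bracket word: no remaining letter lies in a column strictly between \<open>i\<close> and \<open>j\<close>. Within a
  column closing brackets come before opening ones, so further letters in the columns \<open>i\<close> and \<open>j\<close> do
  not separate the pair. The rule \<open>no_bracket\<close> applies when no closing bracket follows an opening one.
\<close>

inductive bracket_poly :: "monomial \<Rightarrow> ('k::field) mpoly \<Rightarrow> bool" where
  no_bracket: "(\<And>i j. X i \<in> keys m \<Longrightarrow> Y j \<in> keys m \<Longrightarrow> j \<le> i) \<Longrightarrow> bracket_poly m (monomial_poly m)"
| bracket: "bracket_poly m b \<Longrightarrow> i < j \<Longrightarrow> (\<And>k. i < k \<Longrightarrow> k < j \<Longrightarrow> k \<notin> columns m) \<Longrightarrow>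
    bracket_poly (var_monomial (X i) + var_monomial (Y j) + m) (minor i j * b)"

lemma bracket_poly_monic: "bracket_poly m b \<Longrightarrow> monic_at m b"
proof (induction rule: bracket_poly.induct)
  case (no_bracket m)
  then show ?case by (simp add: monic_at_def monomial_poly_def)
next
  case (bracket m b i j)
  then show ?case by (intro monic_at_minor_mult)
qed

lemma bracket_poly_column_degree:
  "bracket_poly m b \<Longrightarrow> k \<in> keys b \<Longrightarrow> column_degree k = column_degree m"
proof (induction arbitrary: k rule: bracket_poly.induct)
  case (no_bracket m)
  then show ?case by (simp add: monomial_poly_def)
next
  case (bracket m b i j)
  obtain l where "l \<in> keys b"
    "column_degree k = column_degree (var_monomial (X i) + var_monomial (Y j) + l)"
    using keys_minor_mult[OF bracket.prems] by blast
  then show ?case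
    by (simp only: column_degree_add bracket.IH)
qed

lemma bracket_poly_carrier:
  assumes "bracket_poly m b" "m \<in> monomials n"
  shows "b \<in> carrier (poly_ring n)"
  unfolding carrier_iff
proof
  fix k assume "k \<in> keys b"
  then have "columns k = columns m"
    using bracket_poly_column_degree[OF assms(1)] columns_cong by blast
  then show "k \<in> monomials n"
    using assms(2) by (simp add: monomials_iff_columns)
qed

text \<open>
  An opening and a later closing bracket at minimal distance are adjacent.
\<close>

lemma bracket_poly_exists: "\<exists>b :: ('k::field) mpoly. bracket_poly m b"
proof (induction "\<Sum>v\<in>keys m. lookup m v" arbitrary: m rule: less_induct)
  case less
  show ?case
  proof (cases "\<exists>d i. X i \<in> keys m \<and> Y (i + Suc d) \<in> keys m")
    case False
    have "j \<le> i" if "X i \<in> keys m" "Y j \<in> keys m" for i j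
    proof (rule ccontr)
      assume "\<not> j \<le> i"
      then have "j = i + Suc (j - i - 1)" by simp
      then have "Y (i + Suc (j - i - 1)) \<in> keys m" using that(2) by simp
      then show False using False that(1) by blast
    qed
    then show ?thesis using bracket_poly.no_bracket by blast
  next
    case True
    define d where "d = (LEAST d. \<exists>i. X i \<in> keys m \<and> Y (i + Suc d) \<in> keys m)"
    obtain i where i: "X i \<in> keys m" "Y (i + Suc d) \<in> keys m"
      using LeastI_ex[OF True] unfolding d_def by blast
    have minimal: "\<not> (X p \<in> keys m \<and> Y q \<in> keys m)" if "p < q" "q < p + Suc d" for p q
    proof
      assume *: "X p \<in> keys m \<and> Y q \<in> keys m"
      have "q = p + Suc (q - p - 1)" using that by simp
      then have "d \<le> q - p - 1"
        unfolding d_def using * by (intro Least_le exI[of _ p]) simp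
      with that show False by simp
    qed
    define j where "j = i + Suc d"
    define s where "s = var_monomial (X i) + var_monomial (Y j)"
    define m' where "m' = m - s"
    have m: "m = s + m'"
      using i by (intro poly_mapping_eqI)
        (auto simp: m'_def s_def j_def lookup_add lookup_minus lookup_single when_def in_keys_iff)
    have "keys m' \<subseteq> keys m" by (simp add: m keys_monomial_add)
    have "(\<Sum>v\<in>keys m. lookup m' v) < (\<Sum>v\<in>keys m. lookup m v)"
    proof (rule sum_strict_mono_ex1)
      show "\<forall>v\<in>keys m. lookup m' v \<le> lookup m v"
        by (simp add: m lookup_add)
      show "\<exists>v\<in>keys m. lookup m' v < lookup m v"
        using i(1) by (intro bexI[of _ "X i"]) (simp_all add: m lookup_add s_def)
    qed simp
    moreover have "(\<Sum>v\<in>keys m. lookup m' v) = (\<Sum>v\<in>keys m'. lookup m' v)"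
      using \<open>keys m' \<subseteq> keys m\<close> by (intro sum.mono_neutral_right) (auto simp: in_keys_iff)
    ultimately obtain b :: "'k mpoly" where b: "bracket_poly m' b"
      using less[of m'] by auto
    have "k \<notin> columns m'" if "i < k" "k < j" for k
      using minimal[of i k] minimal[of k j] that i \<open>keys m' \<subseteq> keys m\<close>
      by (auto simp: in_columns_iff j_def)
    then show ?thesis
      using bracket_poly.bracket[OF b, of i j] m by (auto simp: s_def j_def)
  qed
qed

text \<open>
  The common reason for the two membership results below. An opening bracket in column \<open>p\<close> and a later
  closing one in column \<open>q\<close>, with \<open>L p q\<close>, force \<open>b\<close> to contain a minor on columns related by \<open>L\<close>:
  if the pair \<open>i, j\<close> split off from \<open>b\<close> is not related by \<open>L\<close>, then by convexity it does not use the
  letters \<open>x\<^sub>p\<close> and \<open>y\<^sub>q\<close>, which therefore remain after its removal. The set \<open>D\<close> and the cofactor \<open>u\<close>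
  cover the situation in which a minor on \<open>i\<close> and \<open>j\<close> lies in \<open>A\<close> only after multiplication by a
  variable of every other column in \<open>D\<close>. The columns of the rest of \<open>b\<close> supply these factors, and \<open>u\<close>
  keeps track of the minors that have been split off.
\<close>

lemma bracket_poly_in_ideal:
  fixes b :: "('k::field) mpoly"
  assumes "bracket_poly m b"
    and A: "ideal A (poly_ring n)"
    and convex: "\<And>i j p q. L p q \<Longrightarrow> p \<le> i \<Longrightarrow> i < j \<Longrightarrow> j \<le> q \<Longrightarrow> i \<in> W \<Longrightarrow> j \<in> W \<Longrightarrow> L i j"
    and minors: "\<And>i j u. L i j \<Longrightarrow> i < j \<Longrightarrow> i \<in> W \<Longrightarrow> j \<in> W \<Longrightarrow> u \<in> monomials n \<Longrightarrow> D \<subseteq> columns u \<union> {i, j} \<Longrightarrow>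
      monomial_poly u * minor i j \<in> A"
    and "m \<in> monomials n" "u \<in> monomials n" "columns m \<subseteq> W" "D \<subseteq> columns m \<union> columns u"
    and "X p \<in> keys m" "Y q \<in> keys m" "p < q" "L p q"
  shows "monomial_poly u * b \<in> A"
  using assms(1,5-)
proof (induction arbitrary: u rule: bracket_poly.induct)
  case (no_bracket m)
  then show ?case by fastforce
next
  case (bracket m b i j)
  let ?s = "var_monomial (X i) + var_monomial (Y j)" and ?t = "var_monomial (X j) + var_monomial (Y i)"
  have st: "columns ?s = {i, j}" "columns ?t = {i, j}" "columns (?s + m) = insert i (insert j (columns m))"
    by (auto simp: columns_add)
  have mW: "m \<in> monomials n" "columns m \<subseteq> W" "i \<in> W" "j \<in> W"
    using bracket.prems by (auto simp: monomials_add_iff st)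
  have mon: "?s \<in> monomials n" "?t \<in> monomials n"
    using bracket.prems(1) by (auto simp: monomials_add_iff var_monomial_in_monomials)
  show ?case
  proof (cases "L i j")
    case True
    (* Each monomial of b has the columns of m, so it brings the factors that minors asks for. *)
    have "monomial_poly u * (minor i j * b) = (\<Sum>k\<in>keys b. single 0 (lookup b k) * (monomial_poly (u + k) * minor i j))"
    proof -
      have "monomial_poly u * (minor i j * b) = (monomial_poly u * b) * minor i j"
        by (simp add: ac_simps)
      also have "monomial_poly u * b = (\<Sum>k\<in>keys b. single 0 (lookup b k) * monomial_poly (u + k))"
        using arg_cong[OF sum_terms[of b], of "(*) (monomial_poly u)"]
        by (simp add: sum_distrib_left monomial_poly_def mult_single)
      finally show ?thesis by (simp add: sum_distrib_right mult.assoc)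
    qed
    also have "\<dots> \<in> A"
    proof (rule ideal_sum[OF A], rule ideal_mult[OF A])
      fix k assume "k \<in> keys b"
      then have k: "columns k = columns m"
        using bracket_poly_column_degree[OF bracket.hyps(1)] columns_cong by blast
      show "monomial_poly (u + k) * minor i j \<in> A"
      proof (rule minors[OF True \<open>i < j\<close> mW(3,4)])
        show "u + k \<in> monomials n"
          using bracket.prems(2) mW(1) k by (simp add: columns_add monomials_iff_columns)
        show "D \<subseteq> columns (u + k) \<union> {i, j}"
          using bracket.prems(4) by (auto simp: columns_add k st)
      qed
    qed (simp add: carrier_single)
    finally show ?thesis .
  next
    case False
    have cols: "p \<in> columns (?s + m)" "q \<in> columns (?s + m)"
      using bracket.prems(5,6) unfolding in_columns_iff by auto
    (* If p were i, then j would lie between i and q, and if q were j, then i between p and j. *)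
    have gap: "c \<le> i \<or> j \<le> c" if "c \<in> columns (?s + m)" for c
      using that bracket.hyps(3)[of c] unfolding st by force
    have "p \<noteq> i"
      using gap[OF cols(2)] convex[OF bracket.prems(8), of i j] mW(3,4) \<open>i < j\<close> \<open>p < q\<close> False by auto
    moreover have "q \<noteq> j"
      using gap[OF cols(1)] convex[OF bracket.prems(8), of i j] mW(3,4) \<open>i < j\<close> \<open>p < q\<close> False by auto
    ultimately have "X p \<in> keys m" "Y q \<in> keys m"
      using bracket.prems(5,6) by (auto simp: keys_monomial_add)
    then have IH: "monomial_poly (u + r) * b \<in> A" if "r \<in> {?s, ?t}" for r
      using that bracket.prems mW mon by (intro bracket.IH) (auto simp: monomials_add_iff columns_add)
    have "monomial_poly u * (minor i j * b) = monomial_poly (u + ?s) * b - monomial_poly (u + ?t) * b"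
      by (simp add: minor_conv_monomials monomial_poly_mult[symmetric] algebra_simps)
    also have "\<dots> \<in> A"
      using IH by (intro ideal_diff[OF A]) auto
    finally show ?thesis .
  qed
qed

section \<open>Components of induced subgraphs and their primes\<close>

definition linked :: "nat set set \<Rightarrow> nat set \<Rightarrow> nat \<Rightarrow> nat \<Rightarrow> bool" where
  "linked E W = (\<lambda>i j. i \<in> W \<and> j \<in> W \<and> {i, j} \<in> E)\<^sup>*\<^sup>*"

lemma linked_refl [simp]: "linked E W i i"
  by (simp add: linked_def)

lemma linked_trans: "linked E W i j \<Longrightarrow> linked E W j k \<Longrightarrow> linked E W i k"
  unfolding linked_def by (rule rtranclp_trans)

lemma linked_sym: "linked E W i j \<Longrightarrow> linked E W j i"
  unfolding linked_def
  by (rule sympD[OF symp_rtranclp]) (auto intro!: sympI simp: insert_commute)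

lemma linked_edge: "i \<in> W \<Longrightarrow> j \<in> W \<Longrightarrow> {i, j} \<in> E \<Longrightarrow> linked E W i j"
  unfolding linked_def by auto

lemma linked_mono: "linked E W i j \<Longrightarrow> W \<subseteq> W' \<Longrightarrow> linked E W' i j"
  unfolding linked_def by (rule rtranclp_mono[THEN predicate2D, rotated]) auto

lemma linked_in: "linked E W i j \<Longrightarrow> i \<noteq> j \<Longrightarrow> i \<in> W"
  unfolding linked_def by (erule converse_rtranclpE) auto

text \<open>
  A walk can be shortened to one that never returns to its starting point.
\<close>

lemma linked_first_step:
  assumes "linked E W i j" "i \<noteq> j"
  obtains k where "i \<in> W" "k \<in> W" "{i, k} \<in> E" "linked E (W - {i}) k j"
proof -
  let ?P = "\<exists>k. i \<in> W \<and> k \<in> W \<and> {i, k} \<in> E \<and> linked E (W - {i}) k j"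
  have "linked E (W - {i}) a j \<or> ?P" if "linked E W a j" for a
    using that unfolding linked_def[of E W]
  proof (induction rule: converse_rtranclp_induct)
    case (step a b)
    show ?case
    proof (cases "linked E (W - {i}) b j")
      case True
      then have "b \<noteq> i" using assms(2) linked_in[of E "W - {i}" i j] by auto
      show ?thesis
      proof (cases "a = i")
        case True
        then show ?thesis using step.hyps(1) \<open>linked E (W - {i}) b j\<close> by blast
      next
        case False
        then have "linked E (W - {i}) a b"
          using step.hyps(1) \<open>b \<noteq> i\<close> by (intro linked_edge) auto
        then show ?thesis using \<open>linked E (W - {i}) b j\<close> linked_trans by blast
      qed
    next
      case False
      then show ?thesis using step.IH by blast
    qed
  qed simp
  from this[OF assms(1)] have ?P
    using assms(2) linked_in[of E "W - {i}" i j] by blast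
  then show thesis using that by blast
qed

definition component_min :: "nat set set \<Rightarrow> nat set \<Rightarrow> nat \<Rightarrow> nat" where
  "component_min E W i = (LEAST j. linked E W i j)"

lemma component_min_eq_iff: "component_min E W i = component_min E W j \<longleftrightarrow> linked E W i j"
proof
  have rep: "linked E W i (component_min E W i)" for i
    unfolding component_min_def by (rule LeastI[of _ i]) simp
  assume "component_min E W i = component_min E W j"
  then show "linked E W i j"
    using rep[of i] rep[of j] linked_sym linked_trans by metis
next
  assume "linked E W i j"
  then have "linked E W i = linked E W j"
    using linked_sym linked_trans by (intro ext) blast
  then show "component_min E W i = component_min E W j"
    by (simp add: component_min_def)
qed

text \<open>
  The components of the graph on \<open>W\<close> are represented by their least elements \<open>r\<close>. Sending the column
  \<open>(x\<^sub>i, y\<^sub>i)\<close> to \<open>(s\<^sub>i t\<^sub>r, s\<^sub>i)\<close>, where \<open>r\<close> represents the component of \<open>i\<close>, makes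
  all columns of a component proportional. The fresh variables \<open>s\<^sub>i\<close> and \<open>t\<^sub>r\<close> are
  represented by \<open>X i\<close> and \<open>Y r\<close>.
\<close>

definition component_prime :: "nat \<Rightarrow> nat set set \<Rightarrow> nat set \<Rightarrow> ('k::field) mpoly set" where
  "component_prime n E W = subst_kernel n {v. column v \<notin> W}
     (\<lambda>v. case v of X i \<Rightarrow> var_monomial (X i) + var_monomial (Y (component_min E W i))
                  | Y i \<Rightarrow> var_monomial (X i))"

text \<open>
  Describes the monomials of the initial ideal of \<open>component_prime n E W\<close>, by
  \<open>component_prime_leading_monomial\<close> and, for weakly closed labellings,
  \<open>bracket_poly_in_component_prime\<close>.
\<close>

definition in_initial :: "nat set set \<Rightarrow> nat set \<Rightarrow> monomial \<Rightarrow> bool" where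
  "in_initial E W m \<longleftrightarrow> \<not> columns m \<subseteq> W \<or>
     (\<exists>i j. i < j \<and> X i \<in> keys m \<and> Y j \<in> keys m \<and> linked E W i j)"

lemma component_prime_prime:
  "primeideal (component_prime n E W :: ('k::field) mpoly set) (poly_ring n)"
  unfolding component_prime_def by (rule subst_kernel_prime)

lemma component_prime_ideal: "ideal (component_prime n E W :: ('k::field) mpoly set) (poly_ring n)"
  using component_prime_prime primeideal.axioms(1) by blast

lemma component_prime_killed:
  assumes "f \<in> carrier (poly_ring n)" "\<And>k. k \<in> keys f \<Longrightarrow> \<not> columns k \<subseteq> W"
  shows "f \<in> component_prime n E W"
proof -
  have "keys k \<inter> {v. column v \<notin> W} \<noteq> {}" if "k \<in> keys f" for k
    using assms(2)[OF that] by auto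
  then show ?thesis
    using assms(1) by (simp add: component_prime_def subst_kernel_def poly_subst_def)
qed

lemma component_prime_minor:
  assumes "linked E W i j \<or> i \<notin> W \<or> j \<notin> W" "i \<in> {1..n}" "j \<in> {1..n}"
  shows "(minor i j :: ('k::field) mpoly) \<in> component_prime n E W"
proof -
  have sub: "poly_subst Z \<theta> (monomial_poly (var_monomial v + var_monomial w)) =
      (if v \<in> Z \<or> w \<in> Z then 0 else (monomial_poly (\<theta> v + \<theta> w) :: 'k mpoly))" for Z \<theta> v w
  proof -
    have "monomial_subst \<theta> (var_monomial u) = \<theta> u" for u
      by (rule poly_mapping_eqI) (simp add: lookup_monomial_subst[of "{u}"])
    then show ?thesis
      by (simp add: monomial_poly_def poly_subst_single keys_monomial_add monomial_subst_add)
  qed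
  have diff: "poly_subst Z \<theta> (f - g) = poly_subst Z \<theta> f - poly_subst Z \<theta> (g :: 'k mpoly)" for Z \<theta> f g
    using poly_subst_add[of Z \<theta> "f - g" g] by simp
  have "i \<in> W \<Longrightarrow> j \<in> W \<Longrightarrow> component_min E W i = component_min E W j"
    using assms(1) component_min_eq_iff by blast
  then show ?thesis
    using assms(2,3) carrier_minor
    by (auto simp: component_prime_def subst_kernel_def minor_conv_monomials diff sub ac_simps)
qed

text \<open>
  Two monomials in the columns of \<open>W\<close> have the same image under the substitution precisely if they
  have the same column degrees and, in every component, the same total degree in the \<open>x\<close>-variables. A monomial outside
  \<open>in_initial E W\<close> has, in each component, its \<open>x\<close>-factors as far to the right as the column degrees
  permit, and is therefore the least one in its fibre. As a leading monomial its image could not be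
  cancelled by smaller monomials of \<open>f\<close>.
\<close>

lemma component_prime_leading_monomial:
  fixes f :: "('k::field) mpoly"
  assumes f: "f \<in> component_prime n E W" "f \<noteq> 0"
  shows "in_initial E W (leading_monomial f)"
proof (rule ccontr)
  define m where "m = leading_monomial f"
  define \<theta> where "\<theta> = (\<lambda>v. case v of X i \<Rightarrow> var_monomial (X i) + var_monomial (Y (component_min E W i))
                  | Y i \<Rightarrow> var_monomial (X i))"
  let ?\<tau> = "monomial_subst \<theta>"
  assume "\<not> in_initial E W (leading_monomial f)"
  then have mW: "columns m \<subseteq> W"
    and standard: "\<And>i j. i < j \<Longrightarrow> X i \<in> keys m \<Longrightarrow> Y j \<in> keys m \<Longrightarrow> \<not> linked E W i j"
    by (auto simp: in_initial_def m_def)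
  have m: "m \<in> keys f"
    unfolding m_def using f(2) by (rule leading_monomial_in_keys)
  have "0 = lookup (poly_subst {v. column v \<notin> W} \<theta> f) (?\<tau> m)"
    using f(1) by (simp add: component_prime_def subst_kernel_def \<theta>_def)
  also have "\<dots> = (\<Sum>k\<in>keys f. if columns k \<subseteq> W \<and> ?\<tau> k = ?\<tau> m then lookup f k else 0)"
    unfolding poly_subst_def lookup_sum
    by (intro sum.cong) (auto simp: lookup_single when_def)
  finally have sum0: "(\<Sum>k\<in>keys f. if columns k \<subseteq> W \<and> ?\<tau> k = ?\<tau> m then lookup f k else 0) = 0"
    by simp
  have "\<exists>k\<in>keys f. k \<noteq> m \<and> ?\<tau> k = ?\<tau> m"
  proof (rule ccontr)
    assume "\<not> ?thesis"
    then have "(\<Sum>k\<in>keys f. if columns k \<subseteq> W \<and> ?\<tau> k = ?\<tau> m then lookup f k else 0)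
        = (\<Sum>k\<in>keys f. if k = m then lookup f k else 0)"
      using mW by (intro sum.cong) auto
    with sum0 m show False by (simp add: in_keys_iff)
  qed
  then obtain k where k: "k \<in> keys f" "k \<noteq> m" "?\<tau> k = ?\<tau> m" by blast
  have "k < m"
    using keys_le_leading_monomial[OF k(1)] k(2) by (simp add: m_def)
  define C where "C = columns k \<union> columns m"
  define A where "A = X ` C \<union> Y ` C"
  have A: "finite A" "finite C" "keys k \<subseteq> A" "keys m \<subseteq> A"
    using keys_subset_columns[of k] keys_subset_columns[of m] by (auto simp: A_def C_def)
  have sum_A: "(\<Sum>v\<in>A. g v) = (\<Sum>i\<in>C. g (X i)) + (\<Sum>i\<in>C. g (Y i))" for g :: "var \<Rightarrow> nat"
    unfolding A_def using A(2) by (rule sum_over_columns)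
  have lookup_X: "lookup (?\<tau> l) (X i) = column_degree l i" if "keys l \<subseteq> A" for l i
  proof -
    have "lookup (?\<tau> l) (X i) = (\<Sum>p\<in>C. if p = i then column_degree l i else 0)"
      unfolding lookup_monomial_subst[OF A(1) that] sum_A sum.distrib[symmetric]
      by (intro sum.cong) (auto simp: \<theta>_def lookup_add lookup_single when_def column_degree_def)
    also have "\<dots> = column_degree l i"
    proof (cases "i \<in> C")
      case False
      then have "X i \<notin> keys l" "Y i \<notin> keys l" using that by (auto simp: A_def)
      then show ?thesis using False A(2) by (simp add: column_degree_def in_keys_iff)
    qed (use A(2) in simp)
    finally show ?thesis .
  qed
  have lookup_Y: "lookup (?\<tau> l) (Y r) = (\<Sum>p\<in>C. if component_min E W p = r then lookup l (X p) else 0)"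
    if "keys l \<subseteq> A" for l r
    unfolding lookup_monomial_subst[OF A(1) that] sum_A sum.distrib[symmetric]
    by (intro sum.cong) (auto simp: \<theta>_def lookup_add lookup_single when_def)
  have degree: "column_degree k = column_degree m"
    using lookup_X[OF A(3)] lookup_X[OF A(4)] k(3) by (intro ext) simp
  obtain v where v: "lookup k v < lookup m v" "\<And>w. w < v \<Longrightarrow> lookup k w = lookup m w"
    using \<open>k < m\<close> unfolding monomial_less_iff by blast
  obtain i where i: "v = X i"
  proof (cases v)
    case (Y i)
    then have "lookup k (X i) = lookup m (X i)" using v(2) by simp
    then show ?thesis using fun_cong[OF degree, of i] v(1) Y by (simp add: column_degree_def)
  qed auto
  define r where "r = component_min E W i"
  have "X i \<in> keys m" using v(1) i by (auto simp: in_keys_iff)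
  then have "i \<in> C" by (auto simp: C_def in_columns_iff)
  (* k has fewer factors x_i than m, but as many x-factors in the component of i: it has more of *)
  (* them in another column p of that component, which comes after i because k and m agree before. *)
  have "\<exists>p\<in>C. component_min E W p = r \<and> lookup m (X p) < lookup k (X p)"
  proof (rule ccontr)
    assume "\<not> ?thesis"
    then have "lookup (?\<tau> k) (Y r) < lookup (?\<tau> m) (Y r)"
      unfolding lookup_Y[OF A(3)] lookup_Y[OF A(4)]
      using A(2) \<open>i \<in> C\<close> v(1) i r_def by (intro sum_strict_mono_ex1) (auto simp: not_less)
    with k(3) show False by simp
  qed
  then obtain p where p: "component_min E W p = r" "lookup m (X p) < lookup k (X p)" by blast
  have "i < p"
    using v p(2) i by (metis less_var.simps(1) linorder_neqE_nat not_less_iff_gr_or_eq)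
  moreover have "Y p \<in> keys m"
    using fun_cong[OF degree, of p] p(2) by (auto simp: column_degree_def in_keys_iff)
  moreover have "linked E W i p"
    using p(1) by (simp add: r_def component_min_eq_iff[symmetric])
  ultimately show False using standard \<open>X i \<in> keys m\<close> by blast
qed

lemma in_initial_add: "in_initial E W m \<Longrightarrow> in_initial E W (l + m)"
  by (auto simp: in_initial_def columns_add keys_monomial_add)

lemma initial_own_columns:
  "in_initial E (columns m) m \<longleftrightarrow>
    (\<exists>i j. i < j \<and> X i \<in> keys m \<and> Y j \<in> keys m \<and> linked E (columns m) i j)"
  by (simp add: in_initial_def)

text \<open>
  The induced graph on \<open>columns m\<close> is the most restrictive test: if \<open>W\<close> omits a column of \<open>m\<close>, then \<open>m\<close>
  is in the initial ideal trivially, and otherwise \<open>W\<close> links at least as many vertices.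
\<close>

lemma initial_own_columns_imp:
  assumes "in_initial E (columns m) m"
  shows "in_initial E W m"
proof (cases "columns m \<subseteq> W")
  case True
  obtain i j where "i < j" "X i \<in> keys m" "Y j \<in> keys m" "linked E (columns m) i j"
    using assms unfolding initial_own_columns by blast
  moreover from this(4) have "linked E W i j" using True by (rule linked_mono)
  ultimately show ?thesis unfolding in_initial_def by blast
qed (simp add: in_initial_def)

section \<open>Weakly closed labellings\<close>

locale weakly_closed_graph =
  fixes n :: nat and E :: "nat set set"
  assumes edges: "e \<in> E \<Longrightarrow> \<exists>i j. e = {i, j} \<and> 1 \<le> i \<and> i < j \<and> j \<le> n"
    and weakly_closed: "{i, j} \<in> E \<Longrightarrow> i < k \<Longrightarrow> k < j \<Longrightarrow> {i, k} \<in> E \<or> {k, j} \<in> E"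
begin

lemma edge_vertices:
  assumes "{i, j} \<in> E" shows "i \<in> {1..n}" "j \<in> {1..n}" "i \<noteq> j"
  using edges[OF assms] by (auto simp: doubleton_eq_iff)

text \<open>
  A walk from \<open>i\<close> to \<open>j\<close> has an edge that passes over \<open>k\<close> or ends in it, and by weak closedness \<open>k\<close> is
  adjacent to one of the ends of an edge that passes over it.
\<close>

lemma linked_between:
  assumes "linked E W i j" "i < k" "k < j" "k \<in> W"
  shows "linked E W i k"
proof (rule ccontr)
  assume not: "\<not> linked E W i k"
  have "v < k" if "linked E W i v" for v
    using that unfolding linked_def
  proof (induction rule: rtranclp_induct)
    case (step v w)
    have iv: "linked E W i v"
      using step.hyps(1) by (simp add: linked_def)
    have iw: "linked E W i w"
      using iv step.hyps(2) linked_edge[of v W w E] linked_trans by blast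
    show ?case
    proof (rule ccontr)
      assume "\<not> w < k"
      moreover have "w \<noteq> k" using iw not by blast
      ultimately have "{v, k} \<in> E \<or> {k, w} \<in> E"
        using weakly_closed[of v w k] step by simp
      then have "linked E W v k \<or> linked E W w k"
        using step.hyps(2) assms(4) by (auto intro: linked_edge simp: insert_commute)
      then show False using iv iw not linked_trans by blast
    qed
  qed (use assms in simp)
  then show False using assms(1,3) by fastforce
qed

lemma linked_convex:
  assumes "linked E W p q" "p \<le> i" "i < j" "j \<le> q" "i \<in> W" "j \<in> W"
  shows "linked E W i j"
proof -
  have "linked E W p r" if "p \<le> r" "r \<le> q" "r \<in> W" for r
    using linked_between[OF assms(1), of r] assms(1) that by (cases "r = p"; cases "r = q") auto
  then have "linked E W p i" "linked E W p j" using assms by auto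
  then show ?thesis using linked_sym linked_trans by blast
qed

lemma generators_carrier:
  "{var_poly (X i) * var_poly (Y j) - var_poly (X j) * var_poly (Y i) | i j. {i, j} \<in> E \<and> i < j}
    \<subseteq> carrier (poly_ring n :: ('k::field) mpoly ring)"
proof clarify
  fix i j assume "{i, j} \<in> E"
  then show "var_poly (X i) * var_poly (Y j) - var_poly (X j) * var_poly (Y i)
      \<in> carrier (poly_ring n :: 'k mpoly ring)"
    unfolding minor_def[symmetric] by (intro carrier_minor edge_vertices)
qed

lemma edge_ideal_ideal: "ideal (binomial_edge_ideal n E :: ('k::field) mpoly set) (poly_ring n)"
  unfolding binomial_edge_ideal_def
  by (intro ring.genideal_ideal cring.axioms(1) cring_poly_ring generators_carrier)

lemma edge_minor_in_edge_ideal: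
  assumes "{i, j} \<in> E"
  shows "(minor i j :: ('k::field) mpoly) \<in> binomial_edge_ideal n E"
proof -
  have *: "(minor a b :: 'k mpoly) \<in> binomial_edge_ideal n E" if "{a, b} \<in> E" "a < b" for a b
    unfolding binomial_edge_ideal_def minor_def
    by (rule subsetD[OF ring.genideal_self[OF cring.axioms(1)[OF cring_poly_ring] generators_carrier]])
      (use that in blast)
  show ?thesis
  proof (cases "i < j")
    case False
    then have "minor j i \<in> (binomial_edge_ideal n E :: 'k mpoly set)"
      using assms edge_vertices(3)[OF assms] *[of j i] by (simp add: insert_commute)
    then show ?thesis
      using ideal_diff[OF edge_ideal_ideal ideal_zero[OF edge_ideal_ideal], of "minor j i :: 'k mpoly"]
      by (simp add: minor_swap[of i j])
  qed (use assms * in blast)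
qed

lemma edge_ideal_subset_component_prime:
  "(binomial_edge_ideal n E :: ('k::field) mpoly set) \<subseteq> component_prime n E W"
  unfolding binomial_edge_ideal_def
proof (intro ring.genideal_minimal cring.axioms(1) cring_poly_ring component_prime_ideal subsetI)
  fix f :: "'k mpoly"
  assume "f \<in> {var_poly (X i) * var_poly (Y j) - var_poly (X j) * var_poly (Y i) | i j. {i, j} \<in> E \<and> i < j}"
  then obtain i j where f: "f = minor i j" and ij: "{i, j} \<in> E"
    unfolding minor_def by blast
  then show "f \<in> component_prime n E W"
    unfolding f using edge_vertices[OF ij] linked_edge[of i W j E] 
    by (intro component_prime_minor) auto
qed

text \<open>
  By the exchange relations the minor is routed along a path from \<open>i\<close> to \<open>j\<close> in \<open>W\<close>; every interior
  vertex of the path costs one variable of its column, which \<open>u\<close> provides.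
\<close>

lemma linked_minor_in_edge_ideal:
  assumes "linked E W i j" "i \<noteq> j" "W \<subseteq> {1..n}" "u \<in> monomials n" "W \<subseteq> columns u \<union> {i, j}"
  shows "(monomial_poly u * minor i j :: ('k::field) mpoly) \<in> binomial_edge_ideal n E"
  using assms
proof (induction "card W" arbitrary: W i u rule: less_induct)
  case less
  let ?J = "binomial_edge_ideal n E :: 'k mpoly set"
  note J = edge_ideal_ideal[where 'k = 'k]
  obtain k where k: "i \<in> W" "k \<in> W" "{i, k} \<in> E" "linked E (W - {i}) k j"
    using linked_first_step[OF less.prems(1,2)] .
  have ik: "minor i k \<in> ?J" using k(3) by (rule edge_minor_in_edge_ideal)
  show ?case
  proof (cases "k = j")
    case True
    then show ?thesis using ik less.prems(4) by (auto intro: ideal_mult[OF J] carrier_monomial_poly)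
  next
    case False
    have "k \<in> columns u"
      using False k edge_vertices(3)[OF k(3)] less.prems(5) by auto
    then obtain v where v: "v \<in> keys u" "column v = k" by auto
    define u' where "u' = u - var_monomial v"
    have u: "u = u' + var_monomial v"
      using v(1) by (intro poly_mapping_eqI)
        (auto simp: u'_def lookup_add lookup_minus lookup_single when_def in_keys_iff)
    have u': "u' \<in> monomials n" using less.prems(4) by (simp add: u monomials_add_iff)
    define z where "z = (\<lambda>p. case v of X _ \<Rightarrow> X p | Y _ \<Rightarrow> Y p)"
    have z: "column (z p) = p" for p by (cases v) (auto simp: z_def)
    have "i \<in> {1..n}" "j \<in> {1..n}"
      using k less.prems linked_in[OF linked_sym[OF less.prems(1)]] by auto
    have exchange: "var_poly v * minor i j =
        var_poly (z i) * minor k j + var_poly (z j) * (minor i k :: 'k mpoly)"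
      using v(2) minor_exchange[of k i j] by (cases v) (auto simp: z_def)
    have "monomial_poly u * minor i j = monomial_poly u' * (var_poly v * (minor i j :: 'k mpoly))"
      by (simp add: u monomial_poly_mult[symmetric] var_poly_def mult.assoc)
    also have "\<dots> = monomial_poly (u' + var_monomial (z i)) * minor k j
        + (monomial_poly u' * var_poly (z j)) * minor i k"
      unfolding exchange by (simp add: monomial_poly_mult[symmetric] var_poly_def algebra_simps)
    also have "\<dots> \<in> ?J"
    proof (intro ideal_add[OF J])
      show "monomial_poly (u' + var_monomial (z i)) * minor k j \<in> ?J"
      proof (rule less.hyps)
        show "card (W - {i}) < card W"
          using k(1) less.prems(3) finite_subset by (intro psubset_card_mono) auto
        show "u' + var_monomial (z i) \<in> monomials n"
          using u' z \<open>i \<in> {1..n}\<close> by (simp add: monomials_add_iff var_monomial_in_monomials)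
        show "W - {i} \<subseteq> columns (u' + var_monomial (z i)) \<union> {k, j}"
          using less.prems(5) v(2) by (auto simp: u columns_add)
      qed (use k(4) False less.prems(3) in auto)
      show "monomial_poly u' * var_poly (z j) * minor i k \<in> ?J"
        using ik u' z \<open>j \<in> {1..n}\<close>
        by (intro ideal_mult[OF J] carrier_mult carrier_monomial_poly carrier_var_poly) auto
    qed
    finally show ?thesis .
  qed
qed

lemma bracket_poly_in_component_prime:
  fixes b :: "('k::field) mpoly"
  assumes b: "bracket_poly m b" and m: "m \<in> monomials n" and W: "W \<subseteq> {1..n}"
    and init: "in_initial E W m"
  shows "b \<in> component_prime n E W"
proof (cases "columns m \<subseteq> W")
  case False
  show ?thesis
    using False bracket_poly_column_degree[OF b] columns_cong
    by (intro component_prime_killed bracket_poly_carrier[OF b m]) metis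
next
  case True
  then obtain p q where pq: "p < q" "X p \<in> keys m" "Y q \<in> keys m" "linked E W p q"
    using init by (auto simp: in_initial_def)
  have "monomial_poly 0 * b \<in> component_prime n E W"
  proof (rule bracket_poly_in_ideal[OF b component_prime_ideal, where L = "linked E W" and W = W and D = "{}"])
    show "monomial_poly u * minor i j \<in> (component_prime n E W :: 'k mpoly set)"
      if "linked E W i j" "i \<in> W" "j \<in> W" "u \<in> monomials n" for i j u
      using that W by (intro ideal_mult[OF component_prime_ideal] carrier_monomial_poly component_prime_minor) auto
  qed (use linked_convex m True pq in auto)
  then show ?thesis by (simp add: monomial_poly_zero)
qed

text \<open>
  Two columns linked by a path within \<open>columns m\<close>: the interior vertices of the path occur as columns
  of the remaining factors of \<open>b\<close>, as \<open>linked_minor_in_edge_ideal\<close> requires.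
\<close>

lemma bracket_poly_in_edge_ideal:
  fixes b :: "('k::field) mpoly"
  assumes b: "bracket_poly m b" and m: "m \<in> monomials n" and init: "in_initial E (columns m) m"
  shows "b \<in> binomial_edge_ideal n E"
proof -
  obtain p q where pq: "p < q" "X p \<in> keys m" "Y q \<in> keys m" "linked E (columns m) p q"
    using init by (auto simp: initial_own_columns)
  have "monomial_poly 0 * b \<in> binomial_edge_ideal n E"
  proof (rule bracket_poly_in_ideal[OF b edge_ideal_ideal, where L = "linked E (columns m)"
        and W = "columns m" and D = "columns m"])
    show "monomial_poly u * minor i j \<in> (binomial_edge_ideal n E :: 'k mpoly set)"
      if "linked E (columns m) i j" "i < j" "u \<in> monomials n" "columns m \<subseteq> columns u \<union> {i, j}" for i j u
      using that m by (intro linked_minor_in_edge_ideal) (auto simp: monomials_iff_columns)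
  qed (use linked_convex m pq in auto)
  then show ?thesis by (simp add: monomial_poly_zero)
qed

text \<open>
  The leading monomial \<open>m\<close> of an element of the intersection is in the initial ideal of
  \<open>component_prime n E (columns m)\<close>, so the bracket polynomial of \<open>m\<close> lies in the edge ideal and
  reduces that element.
\<close>

lemma component_primes_Int_subset_edge_ideal:
  fixes f :: "('k::field) mpoly"
  assumes "f \<in> carrier (poly_ring n)" "\<And>W. W \<subseteq> {1..n} \<Longrightarrow> f \<in> component_prime n E W"
  shows "f \<in> binomial_edge_ideal n E"
proof -
  let ?I = "{f \<in> carrier (poly_ring n). \<forall>W\<in>Pow {1..n}. f \<in> component_prime n E W} :: 'k mpoly set"
  have "?I \<subseteq> binomial_edge_ideal n E"
  proof (rule leading_monomial_reduction[OF _ edge_ideal_ideal, where M = "\<lambda>m. in_initial E (columns m) m"])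
    show "ideal ?I (poly_ring n)"
      by (rule ideal_carrier_Int) (rule component_prime_ideal)
    fix f :: "'k mpoly" assume f: "f \<in> ?I" "f \<noteq> 0"
    let ?m = "leading_monomial f"
    have "?m \<in> monomials n"
      using f leading_monomial_in_keys[OF f(2)] by (auto simp: carrier_iff)
    then show "in_initial E (columns ?m) ?m"
      using f by (intro component_prime_leading_monomial[of f n]) (auto simp: monomials_iff_columns)
  next
    fix m assume m: "m \<in> monomials n" "in_initial E (columns m) m"
    obtain b :: "'k mpoly" where b: "bracket_poly m b" using bracket_poly_exists by blast
    have "b \<in> binomial_edge_ideal n E"
      using b m by (rule bracket_poly_in_edge_ideal)
    moreover from this have "b \<in> component_prime n E W" for W
      using edge_ideal_subset_component_prime by blast
    ultimately have "b \<in> ?I \<inter> binomial_edge_ideal n E"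
      using bracket_poly_carrier[OF b m(1)] by blast
    then show "\<exists>b\<in>?I \<inter> binomial_edge_ideal n E. monic_at m b \<and> (\<forall>k\<in>keys b. column_degree k = column_degree m)"
      using bracket_poly_monic[OF b] bracket_poly_column_degree[OF b] by blast
  qed
  then show ?thesis using assms by blast
qed

text \<open>
  \<open>component_prime n E W\<close> is spanned by the bracket polynomials of the monomials in its initial ideal.
\<close>

lemma component_prime_mono:
  assumes "W \<subseteq> {1..n}" "W' \<subseteq> {1..n}"
    and le: "\<And>m. m \<in> monomials n \<Longrightarrow> in_initial E W m \<Longrightarrow> in_initial E W' m"
  shows "(component_prime n E W :: ('k::field) mpoly set) \<subseteq> component_prime n E W'"
proof (rule leading_monomial_reduction[OF component_prime_ideal component_prime_ideal, where M = "in_initial E W"])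
  fix m assume m: "m \<in> monomials n" "in_initial E W m"
  obtain b :: "'k mpoly" where b: "bracket_poly m b" using bracket_poly_exists by blast
  show "\<exists>b\<in>component_prime n E W \<inter> component_prime n E W' :: 'k mpoly set.
      monic_at m b \<and> (\<forall>k\<in>keys b. column_degree k = column_degree m)"
    using bracket_poly_in_component_prime[OF b m(1)] assms(1,2) m le[OF m]
      bracket_poly_monic[OF b] bracket_poly_column_degree[OF b] by blast
qed (rule component_prime_leading_monomial)

lemma initial_edge_ideal_iff:
  fixes f :: "('k::field) mpoly"
  shows "f \<in> initial_ideal n (binomial_edge_ideal n E) \<longleftrightarrow>
    f \<in> carrier (poly_ring n) \<and> (\<forall>k\<in>keys f. in_initial E (columns k) k)"
proof -
  let ?J = "binomial_edge_ideal n E :: 'k mpoly set"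
  let ?G = "{monomial_poly (leading_monomial f) | f. f \<in> ?J \<and> f \<noteq> 0} :: 'k mpoly set"
  let ?M = "{f \<in> carrier (poly_ring n). \<forall>k\<in>keys f. in_initial E (columns k) k} :: 'k mpoly set"
  have ring: "ring (poly_ring n :: 'k mpoly ring)"
    by (intro cring.axioms(1) cring_poly_ring)
  have lead: "leading_monomial f \<in> monomials n" if "f \<in> ?J" "f \<noteq> 0" for f
    using leading_monomial_in_keys[OF that(2)] ideal_subset[OF edge_ideal_ideal] that(1) carrier_iff by blast
  then have G: "?G \<subseteq> carrier (poly_ring n)"
    using carrier_monomial_poly by blast
  have "Idl\<^bsub>poly_ring n\<^esub> ?G \<subseteq> ?M"
  proof (rule ring.genideal_minimal[OF ring])
    show "ideal ?M (poly_ring n)"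
    proof (rule ideal_poly_ringI)
      fix f g :: "'k mpoly"
      assume f: "f \<in> carrier (poly_ring n)" and g: "g \<in> ?M"
      have "in_initial E (columns k) k" if k: "k \<in> keys (f * g)" for k
      proof -
        obtain a b where "k = a + b" "b \<in> keys g" using k keys_mult[of f g] by blast
        with g show ?thesis by (auto intro: in_initial_add initial_own_columns_imp)
      qed
      then show "f * g \<in> ?M" using carrier_mult[OF f] g by blast
    next
      fix f g :: "'k mpoly"
      assume fg: "f \<in> ?M" "g \<in> ?M"
      have "in_initial E (columns k) k" if "k \<in> keys (f + g)" for k
        using that Poly_Mapping.keys_add[of f g] fg by blast
      then show "f + g \<in> ?M" using carrier_add[of f n g] fg by blast
    qed (auto simp: carrier_zero)
    have "in_initial E (columns (leading_monomial f)) (leading_monomial f)" if "f \<in> ?J" "f \<noteq> 0" for f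
      using that edge_ideal_subset_component_prime by (intro component_prime_leading_monomial[of f n]) auto
    then show "?G \<subseteq> ?M"
      using lead by (auto simp: monomial_poly_def intro!: carrier_single)
  qed
  moreover have "?M \<subseteq> Idl\<^bsub>poly_ring n\<^esub> ?G"
  proof
    fix f assume f: "f \<in> ?M"
    note I = ring.genideal_ideal[OF ring G]
    have "single 0 (lookup f k) * monomial_poly k \<in> Idl\<^bsub>poly_ring n\<^esub> ?G" if k: "k \<in> keys f" for k
    proof (rule ideal_mult[OF I])
      have k': "k \<in> monomials n" "in_initial E (columns k) k" using f k by (auto simp: carrier_iff)
      obtain b :: "'k mpoly" where b: "bracket_poly k b" using bracket_poly_exists by blast
      have "b \<in> ?J" using b k' by (rule bracket_poly_in_edge_ideal)
      moreover have "b \<noteq> 0" "leading_monomial b = k"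
        using bracket_poly_monic[OF b] monic_at_nonzero monic_at_leading_monomial by blast+
      ultimately have "monomial_poly k \<in> ?G" by blast
      then show "monomial_poly k \<in> Idl\<^bsub>poly_ring n\<^esub> ?G"
        using ring.genideal_self[OF ring G] by blast
    qed (simp add: carrier_single)
    then have "(\<Sum>k\<in>keys f. single 0 (lookup f k) * monomial_poly k) \<in> Idl\<^bsub>poly_ring n\<^esub> ?G"
      by (intro ideal_sum[OF I])
    then show "f \<in> Idl\<^bsub>poly_ring n\<^esub> ?G"
      by (simp add: monomial_poly_def mult_single sum_terms)
  qed
  ultimately show ?thesis unfolding initial_ideal_def by blast
qed

section \<open>Prime colon ideals and the v-number\<close>

abbreviation initial_monomial :: "monomial \<Rightarrow> bool" where
  "initial_monomial m \<equiv> in_initial E (columns m) m"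

text \<open>
  Here \<open>W\<close> plays the part of the prime chosen by prime avoidance. The claim amounts to saying that \<open>W' \<subseteq> W\<close> and that
  two vertices of \<open>W'\<close> in the same block of \<open>W\<close> are in the same block of \<open>W'\<close>. Otherwise a suitable
  small monomial \<open>r\<close> in the initial ideal of \<open>W\<close> (a variable, or \<open>x\<^sub>p y\<^sub>q\<close> with \<open>p\<close> and \<open>q\<close> at the border of
  two blocks of \<open>W'\<close>) cannot bring \<open>m\<close> into the initial ideal of \<open>W'\<close>.
\<close>

lemma in_initial_mono_of_colon:
  assumes W: "W \<subseteq> {1..n}" "W' \<subseteq> {1..n}" and m: "\<not> in_initial E W' m"
    and colon: "\<And>u. u \<in> monomials n \<Longrightarrow> in_initial E W u \<Longrightarrow> initial_monomial (u + m)"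
    and u: "in_initial E W u"
  shows "in_initial E W' u"
proof (cases "columns u \<subseteq> W'")
  case True
  have mW: "columns m \<subseteq> W'"
    and m_std: "\<And>a b. X a \<in> keys m \<Longrightarrow> Y b \<in> keys m \<Longrightarrow> a < b \<Longrightarrow> \<not> linked E W' a b"
    using m by (auto simp: in_initial_def)
  (* A monomial r on W' in the initial ideal of W creates, together with m, a pair linked in W'. *)
  have new_pair: "\<exists>a b. a < b \<and> linked E W' a b \<and> X a \<in> keys r \<union> keys m \<and> Y b \<in> keys r \<union> keys m"
    if "columns r \<subseteq> W'" "in_initial E W r" for r
  proof -
    have "r \<in> monomials n" using that(1) W(2) by (auto simp: monomials_iff_columns)
    then have "in_initial E W' (r + m)"
      using colon that(2) initial_own_columns_imp by blast
    then show ?thesis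
      using that(1) mW unfolding in_initial_def by (auto simp: columns_add keys_monomial_add)
  qed
  have "W' \<subseteq> W"
  proof (rule ccontr)
    assume "\<not> W' \<subseteq> W"
    then obtain t where t: "t \<in> W'" "t \<notin> W" by blast
    then have out: "in_initial E W (var_monomial v)" if "column v = t" for v
      using that by (simp add: in_initial_def)
    (* For t in W' outside W, the variables x_t and y_t create pairs t < b and a < t in m, whose *)
    (* outer ends a < b already form a pair of m. *)
    obtain b where b: "t < b" "linked E W' t b" "Y b \<in> keys m"
      using new_pair[of "var_monomial (X t)"] out[of "X t"] t(1) m_std by auto
    obtain a where a: "a < t" "linked E W' a t" "X a \<in> keys m"
      using new_pair[of "var_monomial (Y t)"] out[of "Y t"] t(1) m_std by auto
    show False
      using m_std[OF a(3) b(3)] a b linked_trans by force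
  qed
  then obtain p q where pq: "p < q" "X p \<in> keys u" "Y q \<in> keys u" "linked E W p q"
    using u True by (auto simp: in_initial_def)
  have inW: "p \<in> W'" "q \<in> W'" using True pq by (auto simp: in_columns_iff)
  have "linked E W' p q"
  proof (rule ccontr)
    assume nlink: "\<not> linked E W' p q"
    (* Between p and q there are neighbours p' < q' in W' that belong to different blocks of W'. *)
    define q' where "q' = (LEAST c. p < c \<and> c \<in> W' \<and> \<not> linked E W' p c)"
    have q': "p < q'" "q' \<in> W'" "\<not> linked E W' p q'" 
      and q'_min: "\<And>c. p < c \<Longrightarrow> c < q' \<Longrightarrow> c \<in> W' \<Longrightarrow> linked E W' p c"
      using LeastI[of "\<lambda>c. p < c \<and> c \<in> W' \<and> \<not> linked E W' p c" q] not_less_Least[of _ "\<lambda>c. p < c \<and> c \<in> W' \<and> \<not> linked E W' p c"] 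
        pq(1) inW(2) nlink unfolding q'_def by blast+
    have "q' \<le> q"
      unfolding q'_def using pq(1) inW(2) nlink by (intro Least_le) blast
    define p' where "p' = Max {c \<in> W'. p \<le> c \<and> c < q'}"
    have fin: "finite {c \<in> W'. p \<le> c \<and> c < q'}" by simp
    have "p' \<in> {c \<in> W'. p \<le> c \<and> c < q'}"
      unfolding p'_def using fin inW(1) q'(1) by (intro Max_in) auto
    then have p': "p' \<in> W'" "p \<le> p'" "p' < q'" by auto
    have p'_max: "c \<le> p'" if "c \<in> W'" "p \<le> c" "c < q'" for c
      unfolding p'_def using that fin by (intro Max_ge) auto
    have "linked E W' p p'"
      using q'_min[of p'] p' by (cases "p' = p") auto
    then have break: "\<not> linked E W' p' q'"
      using q'(3) linked_trans by blast
    have gap: "c \<le> p' \<or> q' \<le> c" if "c \<in> W'" for c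
      using p'_max[OF that] p'(2) by linarith
    have "linked E W p' q'"
      using linked_convex[OF pq(4) p'(2,3) \<open>q' \<le> q\<close>] p'(1) q'(2) \<open>W' \<subseteq> W\<close> by blast
    then have "in_initial E W (var_monomial (X p') + var_monomial (Y q'))"
      using p'(3) by (auto simp: in_initial_def keys_monomial_add)
    then obtain a b where ab: "a < b" "linked E W' a b" "X a \<in> keys m \<or> a = p'" "Y b \<in> keys m \<or> b = q'"
      using new_pair[of "var_monomial (X p') + var_monomial (Y q')"] p'(1) q'(2)
      by (auto simp: keys_monomial_add columns_add)
    have ab_W: "a \<in> W'" "b \<in> W'"
      using ab(1,2) linked_in[of E W' a b] linked_in[of E W' b a] linked_sym[of E W' a b] by auto
    (* A block of W' cannot extend across the border between p' and q'; so a = p' and b = q' are *)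
    (* both impossible, and the pair would be one of m alone. *)
    have "\<not> (a \<le> p' \<and> q' \<le> b)"
      using linked_convex[OF ab(2) _ p'(3) _ p'(1) q'(2)] break by blast
    then have "a \<noteq> p'" "b \<noteq> q'"
      using ab(1) gap[OF ab_W(1)] gap[OF ab_W(2)] p'(3) by auto
    then show False using ab m_std by blast
  qed
  then show ?thesis using pq by (auto simp: in_initial_def)
qed (simp add: in_initial_def)

lemma monomial_mult_in_initial_ideal_iff:
  fixes f :: "('k::field) mpoly"
  assumes "f \<in> carrier (poly_ring n)" "u \<in> monomials n"
  shows "monomial_poly u * f \<in> initial_ideal n (binomial_edge_ideal n E)
    \<longleftrightarrow> (\<forall>k\<in>keys f. initial_monomial (u + k))"
  using carrier_mult[OF carrier_monomial_poly[OF assms(2)] assms(1)]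
  by (simp add: initial_edge_ideal_iff keys_monomial_poly_mult)

text \<open>
  Prime avoidance: if no such \<open>W\<close> and \<open>m\<close> existed, then for every \<open>W\<close> there would be a monomial outside
  the colon ideal that multiplies \<open>f\<close> into the initial ideal of \<open>component_prime n E W\<close>: either \<open>1\<close>, or
  an element of that initial ideal. The product of all these monomials would multiply \<open>f\<close> into the
  intersection \<open>in(J)\<close> of the initial ideals, which contradicts the primeness of the colon ideal.
\<close>

lemma initial_ideal_prime_colon:
  fixes f :: "('k::field) mpoly"
  assumes f: "f \<in> carrier (poly_ring n)"
    and prime: "primeideal (colon_ideal n (initial_ideal n (binomial_edge_ideal n E)) f) (poly_ring n)"
  obtains W m where "W \<subseteq> {1..n}" "m \<in> keys f" "\<not> in_initial E W m"
    "\<And>u. u \<in> monomials n \<Longrightarrow> in_initial E W u \<Longrightarrow> initial_monomial (u + m)"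
proof (rule ccontr)
  define Q where "Q = colon_ideal n (initial_ideal n (binomial_edge_ideal n E)) f"
  have Q: "monomial_poly u \<in> Q \<longleftrightarrow> (\<forall>k\<in>keys f. initial_monomial (u + k))" if "u \<in> monomials n" for u
    unfolding Q_def colon_ideal_def
    using monomial_mult_in_initial_ideal_iff[OF f that] carrier_monomial_poly[OF that] by blast
  have zero: "monomial_poly 0 \<notin> Q"
  proof
    assume "monomial_poly 0 \<in> Q"
    then have "\<one>\<^bsub>poly_ring n\<^esub> \<in> Q" by (simp add: monomial_poly_zero)
    then show False
      using ideal.one_imp_carrier primeideal.axioms(1)[OF prime] primeideal.I_notcarr[OF prime]
      unfolding Q_def by blast
  qed
  note witness = that
  assume "\<not> thesis"
  have none: "\<exists>u\<in>monomials n. in_initial E W u \<and> \<not> initial_monomial (u + m)"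
    if "W \<subseteq> {1..n}" "m \<in> keys f" "\<not> in_initial E W m" for W m
    using \<open>\<not> thesis\<close> witness[OF that] by blast
  have "\<exists>u. u \<in> monomials n \<and> monomial_poly u \<notin> Q \<and> (\<forall>k\<in>keys f. in_initial E W (u + k))"
    if W: "W \<in> Pow {1..n}" for W
  proof (cases "\<forall>k\<in>keys f. in_initial E W k")
    case True
    then show ?thesis using zero by (intro exI[of _ 0]) simp
  next
    case False
    then obtain m where m: "m \<in> keys f" "\<not> in_initial E W m" by blast
    then obtain u where u: "u \<in> monomials n" "in_initial E W u" "\<not> initial_monomial (u + m)"
      using none[of W m] W by blast
    have "in_initial E W (u + k)" for k
      using in_initial_add[OF u(2), of k] by (simp add: add.commute)
    then show ?thesis using u m(1) Q[OF u(1)] by blast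
  qed
  then obtain U where U: "\<And>W. W \<in> Pow {1..n} \<Longrightarrow> U W \<in> monomials n \<and> monomial_poly (U W) \<notin> Q \<and>
      (\<forall>k\<in>keys f. in_initial E W (U W + k))"
    by metis
  have "sum U F \<in> monomials n \<and> monomial_poly (sum U F) \<notin> Q" if "F \<subseteq> Pow {1..n}" for F
    using finite_subset[OF that finite_Pow_iff[THEN iffD2, OF finite_atLeastAtMost]] that
  proof (induction F rule: finite_induct)
    case empty
    then show ?case using zero by simp
  next
    case (insert W F)
    have UW: "U W \<in> monomials n" "monomial_poly (U W) \<notin> Q" and UF: "sum U F \<in> monomials n" "monomial_poly (sum U F) \<notin> Q"
      using insert U by auto
    have "monomial_poly (U W) * monomial_poly (sum U F) \<notin> Q"
      using primeideal.I_prime[OF prime carrier_monomial_poly[OF UW(1)] carrier_monomial_poly[OF UF(1)]]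
        UW(2) UF(2) unfolding Q_def by auto
    then show ?case
      using insert.hyps UW(1) UF(1) by (simp add: monomial_poly_mult monomials_add_iff)
  qed
  from this[of "Pow {1..n}"] have S: "sum U (Pow {1..n}) \<in> monomials n" "monomial_poly (sum U (Pow {1..n})) \<notin> Q"
    by auto
  have "initial_monomial (sum U (Pow {1..n}) + k)" if k: "k \<in> keys f" for k
  proof -
    let ?c = "columns (sum U (Pow {1..n}) + k)"
    have "k \<in> monomials n" using f k by (auto simp: carrier_iff)
    then have c: "?c \<in> Pow {1..n}"
      using S(1) by (simp add: monomials_iff_columns columns_add)
    have "sum U (Pow {1..n}) + k = sum U (Pow {1..n} - {?c}) + (U ?c + k)"
      using sum.remove[OF _ c, of U] by (simp add: ac_simps)
    then show ?thesis
      using U[OF c] k in_initial_add by metis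
  qed
  then show False using S Q by blast
qed

text \<open>
  For \<open>h\<close> in \<open>component_prime n E W\<close> the product \<open>h b\<close> lies in every \<open>component_prime n E W'\<close>: through \<open>b\<close>
  if \<open>m\<close> is in the initial ideal of the latter, and through \<open>h\<close> otherwise. Conversely, \<open>b\<close> itself is
  not in \<open>component_prime n E W\<close>, since its leading monomial is not in the initial ideal.
\<close>

lemma edge_ideal_colon:
  fixes b :: "('k::field) mpoly"
  assumes b: "bracket_poly m b" and m: "m \<in> monomials n" and W: "W \<subseteq> {1..n}" and notin: "\<not> in_initial E W m"
    and colon: "\<And>u. u \<in> monomials n \<Longrightarrow> in_initial E W u \<Longrightarrow> initial_monomial (u + m)"
  shows "colon_ideal n (binomial_edge_ideal n E) b = component_prime n E W"
proof
  have bc: "b \<in> carrier (poly_ring n)" using b m by (rule bracket_poly_carrier)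
  have "b \<notin> component_prime n E W"
    using component_prime_leading_monomial[of b n E W] notin bracket_poly_monic[OF b]
      monic_at_nonzero monic_at_leading_monomial by metis
  then show "colon_ideal n (binomial_edge_ideal n E) b \<subseteq> component_prime n E W"
    using primeideal.I_prime[OF component_prime_prime _ bc] edge_ideal_subset_component_prime
    unfolding colon_ideal_def poly_ring_simps by blast
  show "component_prime n E W \<subseteq> colon_ideal n (binomial_edge_ideal n E) b"
  proof
    fix h :: "'k mpoly" assume h: "h \<in> component_prime n E W"
    then have hc: "h \<in> carrier (poly_ring n)" using ideal_subset[OF component_prime_ideal] by blast
    have "h * b \<in> component_prime n E W'" if W': "W' \<subseteq> {1..n}" for W'
    proof (cases "in_initial E W' m")
      case True
      then show ?thesis
        using bracket_poly_in_component_prime[OF b m W'] ideal_mult[OF component_prime_ideal hc] by blast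
    next
      case False
      have "component_prime n E W \<subseteq> (component_prime n E W' :: 'k mpoly set)"
        using W W' by (rule component_prime_mono) (rule in_initial_mono_of_colon[OF W W' False colon])
      then show ?thesis
        using h ideal_mult[OF component_prime_ideal bc] by (auto simp: mult.commute[of h])
    qed
    then have "h * b \<in> binomial_edge_ideal n E"
      using carrier_mult[OF hc bc] component_primes_Int_subset_edge_ideal by blast
    then show "h \<in> colon_ideal n (binomial_edge_ideal n E) b"
      using hc by (simp add: colon_ideal_def)
  qed
qed

lemma associated_prime_transfer:
  fixes f :: "('k::field) mpoly"
  assumes f: "f \<in> graded_component n d"
    and P: "P \<in> associated_primes n (initial_ideal n (binomial_edge_ideal n E))"
    "colon_ideal n (initial_ideal n (binomial_edge_ideal n E)) f = P"
  shows "\<exists>g\<in>graded_component n d. \<exists>P\<in>associated_primes n (binomial_edge_ideal n E :: 'k mpoly set).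
    colon_ideal n (binomial_edge_ideal n E) g = P"
proof -
  have fc: "f \<in> carrier (poly_ring n)" using f by (simp add: graded_component_def)
  obtain W m where Wm: "W \<subseteq> {1..n}" "m \<in> keys f" "\<not> in_initial E W m"
    "\<And>u. u \<in> monomials n \<Longrightarrow> in_initial E W u \<Longrightarrow> initial_monomial (u + m)"
    using initial_ideal_prime_colon[OF fc] P by (auto simp: associated_primes_def)
  have m: "m \<in> monomials n" "monomial_degree m = d"
    using f fc Wm(2) by (auto simp: carrier_iff graded_component_def)
  obtain b :: "'k mpoly" where b: "bracket_poly m b" using bracket_poly_exists by blast
  note bc = bracket_poly_carrier[OF b m(1)]
  have "monomial_degree k = d" if "k \<in> keys b" for k
    using bracket_poly_column_degree[OF b that] columns_cong m(2)
    unfolding monomial_degree_columns by metis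
  then have "b \<in> graded_component n d"
    using bc by (simp add: graded_component_def)
  moreover note colon = edge_ideal_colon[OF b m(1) Wm(1,3,4)]
  moreover have "component_prime n E W \<in> associated_primes n (binomial_edge_ideal n E :: 'k mpoly set)"
    using component_prime_prime bc colon unfolding associated_primes_def by blast
  ultimately show ?thesis by blast
qed

text \<open>
  Membership of a monomial in \<open>in(J)\<close> depends only on its set of variables. For a maximal set \<open>U\<close> of
  variables whose product \<open>m\<close> is not in \<open>in(J)\<close>, the ideal \<open>(in(J) : m)\<close> is generated by the variables
  outside \<open>U\<close>.
\<close>

lemma initial_ideal_has_associated_prime:
  "\<exists>d. \<exists>f\<in>graded_component n d.
    \<exists>P\<in>associated_primes n (initial_ideal n (binomial_edge_ideal n E) :: ('k::field) mpoly set).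
      colon_ideal n (initial_ideal n (binomial_edge_ideal n E)) f = P"
proof -
  let ?I = "initial_ideal n (binomial_edge_ideal n E) :: 'k mpoly set"
  define N where "N = (\<lambda>U. \<exists>i j. i < j \<and> X i \<in> U \<and> Y j \<in> U \<and> linked E (column ` U) i j)"
  have N: "initial_monomial k \<longleftrightarrow> N (keys k)" for k
    unfolding initial_own_columns N_def ..
  have N_mono: "N U'" if "N U" "U \<subseteq> U'" for U U'
    using that linked_mono[of E "column ` U" _ _ "column ` U'"] unfolding N_def by blast
  have "finite (variables n)" by (simp add: variables_def)
  define S where "S = {U \<in> Pow (variables n). \<not> N U}"
  have "finite S" unfolding S_def using \<open>finite (variables n)\<close> by simp
  moreover have "{} \<in> S" by (simp add: S_def N_def)
  ultimately obtain U where "U \<in> S" "\<forall>U'\<in>S. U \<subseteq> U' \<longrightarrow> U = U'"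
    using finite_has_maximal[of S] by blast
  then have U: "U \<subseteq> variables n" "\<not> N U"
    and max: "\<And>U'. U' \<subseteq> variables n \<Longrightarrow> \<not> N U' \<Longrightarrow> U \<subseteq> U' \<Longrightarrow> U = U'"
    unfolding S_def by simp_all
  have finU: "finite U" using U(1) \<open>finite (variables n)\<close> finite_subset by blast
  define m where "m = (\<Sum>v\<in>U. var_monomial v)"
  have keys_m: "keys m = U"
    using finU by (auto simp: m_def in_keys_iff lookup_sum lookup_single when_def split: if_splits)
  have m: "m \<in> monomials n" using U(1) by (simp add: monomials_def keys_m)
  let ?P = "subst_kernel n (- U) var_monomial :: 'k mpoly set"
  have colon: "colon_ideal n ?I (monomial_poly m) = ?P"
  proof -
    have "f \<in> colon_ideal n ?I (monomial_poly m) \<longleftrightarrow> f \<in> ?P" if f: "f \<in> carrier (poly_ring n)" for f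
    proof -
      have initial_iff: "initial_monomial (m + k) \<longleftrightarrow> \<not> keys k \<subseteq> U" if k: "k \<in> keys f" for k
      proof -
        have eq: "initial_monomial (m + k) \<longleftrightarrow> N (U \<union> keys k)"
          using N[of "m + k"] unfolding keys_monomial_add keys_m .
        have "keys k \<subseteq> variables n"
          using f k by (auto simp: carrier_iff monomials_def)
        then have "N (U \<union> keys k)" if "\<not> keys k \<subseteq> U"
          using max[of "U \<union> keys k"] U(1) that by blast
        moreover have "U \<union> keys k = U" if "keys k \<subseteq> U"
          using that by blast
        ultimately show ?thesis
          using U(2) eq by (cases "keys k \<subseteq> U") simp_all
      qed
      have subst_id: "monomial_subst var_monomial k = k" for k
        by (rule poly_mapping_eqI)
          (simp add: lookup_monomial_subst[of "keys k"] lookup_single when_def in_keys_iff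
            if_distrib[of "(*) _"] cong: if_cong)
      have lookup_subst: "lookup (poly_subst (- U) var_monomial f) k = (if keys k \<subseteq> U then lookup f k else 0)" for k
      proof -
        have "lookup (poly_subst (- U) var_monomial f) k =
            (\<Sum>l\<in>keys f. if l = k then (if keys k \<subseteq> U then lookup f k else 0) else 0)"
          unfolding poly_subst_def lookup_sum subst_id
          by (intro sum.cong) (auto simp: lookup_single when_def)
        then show ?thesis by (simp add: in_keys_iff)
      qed
      have "f \<in> ?P \<longleftrightarrow> (\<forall>k. lookup (poly_subst (- U) var_monomial f) k = 0)"
        using f by (simp add: subst_kernel_def poly_mapping_eq_iff fun_eq_iff)
      also have "\<dots> \<longleftrightarrow> (\<forall>k\<in>keys f. \<not> keys k \<subseteq> U)"
        unfolding lookup_subst by (auto simp: in_keys_iff)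
      also have "\<dots> \<longleftrightarrow> (\<forall>k\<in>keys f. initial_monomial (m + k))"
        using initial_iff by blast
      also have "\<dots> \<longleftrightarrow> f \<in> colon_ideal n ?I (monomial_poly m)"
        using f monomial_mult_in_initial_ideal_iff[OF f m]
        by (simp add: colon_ideal_def mult.commute)
      finally show ?thesis ..
    qed
    then show ?thesis
      by (auto simp: colon_ideal_def subst_kernel_def)
  qed
  have "monomial_poly m \<in> (graded_component n (monomial_degree m) :: 'k mpoly set)"
    using carrier_monomial_poly[OF m] by (simp add: graded_component_def monomial_poly_def)
  moreover have "?P \<in> associated_primes n ?I"
    using subst_kernel_prime[of n "- U" var_monomial] carrier_monomial_poly[OF m] colon
    unfolding associated_primes_def by blast
  ultimately show ?thesis using colon by blast
qed

theorem v_number_le_v_number_initial_ideal: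
  "v_number n (binomial_edge_ideal n E :: ('k::field) mpoly set)
    \<le> v_number n (initial_ideal n (binomial_edge_ideal n E) :: 'k mpoly set)"
proof -
  let ?J = "binomial_edge_ideal n E :: 'k mpoly set"
  obtain f where "f \<in> graded_component n (v_number n (initial_ideal n ?J))"
    "\<exists>P\<in>associated_primes n (initial_ideal n ?J). colon_ideal n (initial_ideal n ?J) f = P"
    using LeastI_ex[OF initial_ideal_has_associated_prime[where 'k = 'k]] unfolding v_number_def by blast
  then show ?thesis
    unfolding v_number_def[of n ?J] by (intro Least_le) (blast intro: associated_prime_transfer)
qed

end

lemma weakly_closed_graph_relabel:
  assumes "simple_graph V E" "weakly_closed_labelling V E \<phi>"
  shows "weakly_closed_graph (card V) (relabel \<phi> E)"
proof
  have bij: "bij_betw \<phi> V {1..card V}"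
    using assms(2) by (simp add: weakly_closed_labelling_def)
  fix e assume "e \<in> relabel \<phi> E"
  then obtain a b where ab: "a \<in> V" "b \<in> V" "a \<noteq> b" "e = {\<phi> a, \<phi> b}"
    using assms(1) by (fastforce simp: relabel_def simple_graph_def card_2_iff)
  then have "\<phi> a \<noteq> \<phi> b" "\<phi> a \<in> {1..card V}" "\<phi> b \<in> {1..card V}"
    using bij by (auto simp: bij_betw_def inj_on_def)
  then show "\<exists>i j. e = {i, j} \<and> 1 \<le> i \<and> i < j \<and> j \<le> card V"
    using ab(4) by (cases "\<phi> a < \<phi> b") (force simp: insert_commute)+
next
  fix i j k
  assume "{i, j} \<in> relabel \<phi> E" "i < k" "k < j"
  then show "{i, k} \<in> relabel \<phi> E \<or> {k, j} \<in> relabel \<phi> E"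
    using assms(2) unfolding weakly_closed_labelling_def by simp
qed

theorem corollary3p17:
  fixes V :: "'v set" and E :: "'v set set" and \<phi> :: "'v \<Rightarrow> nat"
  assumes "simple_graph V E"
    and "weakly_closed_labelling V E \<phi>"
  shows "v_number (card V) (binomial_edge_ideal (card V) (relabel \<phi> E) :: ('k::field) mpoly set)
       \<le> v_number (card V)
            (initial_ideal (card V) (binomial_edge_ideal (card V) (relabel \<phi> E) :: 'k mpoly set))"
  using weakly_closed_graph.v_number_le_v_number_initial_ideal[OF weakly_closed_graph_relabel[OF assms]] .

end
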